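(* Let $\Bbbk$ be a field, let $\Delta$ be a finite simplicial complex on $[m]=\{1,\dots,m\}$ without ghost vertices, let $n_1,\dots,n_m\ge 2$ be integers, and put $A_{\Delta,\mathbf n}=\Bbbk[x_1,\dots,x_m]/\bigl(I_\Delta+(x_1^{n_1},\dots,x_m^{n_m})\bigr)$. Let $\mathcal S(\Delta)$ be the set of connected components $C$ of $\Delta^{(1)}$ (identified with their vertex sets) for which $\Delta|_C=2^C$. Assume that $A_{\Delta,\mathbf n}$ is non-Gorenstein and nearly Gorenstein. Then the Teter number of $A_{\Delta,\mathbf n}$ equals $$\max\bigl(\{1\}\cup\{|C|:C\in\mathcal S(\Delta)\}\bigr).$$ In particular, $A_{\Delta,\mathbf n}$ is of Teter type if and only if every $C\in\mathcal S(\Delta)$ is a singleton.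
   Context: A simplicial complex $\Delta$ on $[m]$ is a set of subsets (faces) of $[m]$ closed under taking subsets and containing $\varnothing$. A vertex $i$ is a ghost vertex if $\{i\}\notin\Delta$. For $F\subseteq[m]$ put $x_F=\prod_{i\in F}x_i$; $I_\Delta=(x_F: F\subseteq[m],\ F\notin\Delta)$ is the Stanley--Reisner ideal. For $C\subseteq[m]$, $\Delta|_C=\{F\in\Delta:F\subseteq C\}$ and $2^C$ is the full simplex (all subsets of $C$). The $1$-skeleton $\Delta^{(1)}$ is the graph on the non-ghost vertices whose edges are the two-element faces of $\Delta$. For an Artinian positively graded $\Bbbk$-algebra $A$ (with $A_0=\Bbbk$), with graded maximal ideal $\mathfrak m_A$, the canonical module is $\omega_A=\operatorname{Hom}_{\Bbbk}(A,\Bbbk)$ with $(a\lambda)(b)=\lambda(ab)$, and the canonical trace is the ideal $\operatorname{tr}_A(\omega_A)=\sum_{\varphi\in\operatorname{Hom}_A(\omega_A,A)}\varphi(\omega_A)$. $A$ is Gorenstein if and only if its socle $0:_A\mathfrak m_A$ is one-dimensional over $\Bbbk$; $A$ is nearly Gorenstein if $\mathfrak m_A\subseteq\operatorname{tr}_A(\omega_A)$. The Teter number of $A$ is the smallest integer $s$ for which there are $A$-linear maps $\varphi_1,\dots,\varphi_s:\omega_A\to A$ (arbitrary, not required to be graded) with $\operatorname{tr}_A(\omega_A)=\varphi_1(\omega_A)+\cdots+\varphi_s(\omega_A)$. A non-Gorenstein algebra with Teter number one is said to be of Teter type. *)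

theory Defs
  imports
    "HOL-Algebra.Algebraic_Closure_Type"
    "HOL-Algebra.Embedded_Algebras"
    "HOL-Library.Poly_Mapping"
begin

section \<open>Simplicial complexes\<close>

definition simplicial_complex :: "'v set \<Rightarrow> 'v set set \<Rightarrow> bool" where
  "simplicial_complex V \<Delta> \<longleftrightarrow>
     \<Delta> \<subseteq> Pow V \<and> {} \<in> \<Delta> \<and> (\<forall>F\<in>\<Delta>. \<forall>G. G \<subseteq> F \<longrightarrow> G \<in> \<Delta>)"

definition ghost_vertex :: "'v set set \<Rightarrow> 'v \<Rightarrow> bool" where
  "ghost_vertex \<Delta> i \<longleftrightarrow> {i} \<notin> \<Delta>"

definition restrict_complex :: "'v set set \<Rightarrow> 'v set \<Rightarrow> 'v set set" where
  "restrict_complex \<Delta> C = {F \<in> \<Delta>. F \<subseteq> C}"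

definition skeleton_vertices :: "'v set \<Rightarrow> 'v set set \<Rightarrow> 'v set" where
  "skeleton_vertices V \<Delta> = {i \<in> V. \<not> ghost_vertex \<Delta> i}"

definition skeleton_adj :: "'v set set \<Rightarrow> ('v \<times> 'v) set" where
  "skeleton_adj \<Delta> = {(i, j). i \<noteq> j \<and> {i, j} \<in> \<Delta>}"

definition skeleton_components :: "'v set \<Rightarrow> 'v set set \<Rightarrow> 'v set set" where
  "skeleton_components V \<Delta> =
     skeleton_vertices V \<Delta> //
       ((skeleton_adj \<Delta>)\<^sup>* \<inter> skeleton_vertices V \<Delta> \<times> skeleton_vertices V \<Delta>)"

definition simplex_components :: "'v set \<Rightarrow> 'v set set \<Rightarrow> 'v set set" where
  "simplex_components V \<Delta> =
     {C \<in> skeleton_components V \<Delta>. restrict_complex \<Delta> C = Pow C}"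


section \<open>Canonical module, canonical trace and Teter number\<close>

text \<open>Throughout, \<open>K\<close> is the ground field and \<open>A\<close> a commutative \<open>K\<close>-algebra. The fields
  \<open>mult\<close> and \<open>one\<close> of a record that is only used as a module are irrelevant.\<close>

definition regular_module :: "('a, 'm) ring_scheme \<Rightarrow> ('a, 'a) module" where
  "regular_module R =
     \<lparr>carrier = carrier R, monoid.mult = monoid.mult R, one = one R, zero = zero R, add = add R,
      module.smult = monoid.mult R\<rparr>"

definition module_hom ::
    "('r, 'x) ring_scheme \<Rightarrow> ('r, 'a, 'y) module_scheme \<Rightarrow> ('r, 'b, 'z) module_scheme
      \<Rightarrow> ('a \<Rightarrow> 'b) set" where
  "module_hom R M N =
     {f \<in> carrier M \<rightarrow>\<^sub>E carrier N.
        (\<forall>u\<in>carrier M. \<forall>v\<in>carrier M. f (u \<oplus>\<^bsub>M\<^esub> v) = f u \<oplus>\<^bsub>N\<^esub> f v) \<and>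
        (\<forall>r\<in>carrier R. \<forall>u\<in>carrier M. f (r \<odot>\<^bsub>M\<^esub> u) = r \<odot>\<^bsub>N\<^esub> f u)}"

definition canonical_module ::
    "('k, 'x) ring_scheme \<Rightarrow> ('k, 'a, 'y) module_scheme \<Rightarrow> ('a, 'a \<Rightarrow> 'k) module" where
  "canonical_module K A =
     \<lparr>carrier = module_hom K A (regular_module K),
      monoid.mult = undefined, one = undefined,
      zero = (\<lambda>b\<in>carrier A. \<zero>\<^bsub>K\<^esub>),
      add = (\<lambda>f g. \<lambda>b\<in>carrier A. f b \<oplus>\<^bsub>K\<^esub> g b),
      module.smult = (\<lambda>a f. \<lambda>b\<in>carrier A. f (a \<otimes>\<^bsub>A\<^esub> b))\<rparr>"

text \<open>The sum of a (possibly infinite) family of additive subgroups: all finite sums of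
  elements taken from its members.\<close>

definition family_sum :: "('a, 'm) ring_scheme \<Rightarrow> ('i \<Rightarrow> 'a set) \<Rightarrow> 'i set \<Rightarrow> 'a set" where
  "family_sum R U I =
     {finsum R a J | a J. finite J \<and> J \<subseteq> I \<and> (\<forall>j\<in>J. a j \<in> U j)}"

abbreviation canonical_homs ::
    "('k, 'x) ring_scheme \<Rightarrow> ('k, 'a, 'y) module_scheme \<Rightarrow> (('a \<Rightarrow> 'k) \<Rightarrow> 'a) set" where
  "canonical_homs K A \<equiv> module_hom A (canonical_module K A) (regular_module A)"

definition canonical_trace ::
    "('k, 'x) ring_scheme \<Rightarrow> ('k, 'a, 'y) module_scheme \<Rightarrow> 'a set" where
  "canonical_trace K A =
     family_sum A (\<lambda>\<phi>. \<phi> ` carrier (canonical_module K A)) (canonical_homs K A)"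

definition teter_number ::
    "('k, 'x) ring_scheme \<Rightarrow> ('k, 'a, 'y) module_scheme \<Rightarrow> nat" where
  "teter_number K A =
     (LEAST s. \<exists>\<phi>. (\<forall>i\<in>{1..s}. \<phi> i \<in> canonical_homs K A) \<and>
        canonical_trace K A =
          family_sum A (\<lambda>i. \<phi> i ` carrier (canonical_module K A)) {1..s})"

text \<open>A grading is passed as the family of its homogeneous components \<open>gr d\<close>.\<close>

definition graded_maximal_ideal :: "('a, 'm) ring_scheme \<Rightarrow> (nat \<Rightarrow> 'a set) \<Rightarrow> 'a set" where
  "graded_maximal_ideal A gr = family_sum A gr {1..}"

definition socle :: "('a, 'm) ring_scheme \<Rightarrow> (nat \<Rightarrow> 'a set) \<Rightarrow> 'a set" where
  "socle A gr =
     {a \<in> carrier A. \<forall>b\<in>graded_maximal_ideal A gr. b \<otimes>\<^bsub>A\<^esub> a = \<zero>\<^bsub>A\<^esub>}"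

text \<open>The library measures dimension over a subfield of the ring, so \<open>K\<close> is replaced by its
  image in \<open>A\<close>. For Artinian graded \<open>A\<close> with \<open>A\<^sub>0 = K\<close>, being Gorenstein means that the socle is
  one-dimensional over \<open>K\<close>.\<close>

definition gorenstein ::
    "('k, 'x) ring_scheme \<Rightarrow> ('k, 'a, 'y) module_scheme \<Rightarrow> (nat \<Rightarrow> 'a set) \<Rightarrow> bool" where
  "gorenstein K A gr \<longleftrightarrow>
     ring.dimension A 1 ((\<lambda>c. c \<odot>\<^bsub>A\<^esub> \<one>\<^bsub>A\<^esub>) ` carrier K) (socle A gr)"

definition nearly_gorenstein ::
    "('k, 'x) ring_scheme \<Rightarrow> ('k, 'a, 'y) module_scheme \<Rightarrow> (nat \<Rightarrow> 'a set) \<Rightarrow> bool" where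
  "nearly_gorenstein K A gr \<longleftrightarrow> graded_maximal_ideal A gr \<subseteq> canonical_trace K A"

definition teter_type ::
    "('k, 'x) ring_scheme \<Rightarrow> ('k, 'a, 'y) module_scheme \<Rightarrow> (nat \<Rightarrow> 'a set) \<Rightarrow> bool" where
  "teter_type K A gr \<longleftrightarrow> \<not> gorenstein K A gr \<and> teter_number K A = 1"


section \<open>Polynomial rings and Artinian reductions of Stanley--Reisner rings\<close>

text \<open>A monomial is an exponent vector \<open>nat \<Rightarrow>\<^sub>0 nat\<close>, and multiplication on
  \<open>(nat \<Rightarrow>\<^sub>0 nat) \<Rightarrow>\<^sub>0 'k\<close> is convolution, so this type is the polynomial ring over \<open>'k\<close> in variables
  indexed by all naturals; \<open>poly_algebra V\<close> is its subalgebra of polynomials in the variables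
  indexed by \<open>V\<close>.\<close>

type_synonym 'k mpoly = "(nat \<Rightarrow>\<^sub>0 nat) \<Rightarrow>\<^sub>0 'k"

definition poly_algebra :: "nat set \<Rightarrow> ('k::field, 'k mpoly) module" where
  "poly_algebra V =
     \<lparr>carrier = {p. \<forall>t\<in>Poly_Mapping.keys p. Poly_Mapping.keys t \<subseteq> V},
      monoid.mult = (*), one = 1, zero = 0, add = (+),
      module.smult = (\<lambda>c p. Poly_Mapping.single 0 c * p)\<rparr>"

definition var :: "nat \<Rightarrow> 'k::field mpoly" where
  "var i = Poly_Mapping.single (Poly_Mapping.single i 1) 1"

definition total_degree :: "(nat \<Rightarrow>\<^sub>0 nat) \<Rightarrow> nat" where
  "total_degree t = (\<Sum>i\<in>Poly_Mapping.keys t. Poly_Mapping.lookup t i)"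

definition homogeneous_polys :: "nat set \<Rightarrow> nat \<Rightarrow> 'k::field mpoly set" where
  "homogeneous_polys V d = {p \<in> carrier (poly_algebra V). \<forall>t\<in>Poly_Mapping.keys p. total_degree t = d}"

definition stanley_reisner_ideal :: "nat \<Rightarrow> nat set set \<Rightarrow> 'k::field mpoly set" where
  "stanley_reisner_ideal m \<Delta> =
     Idl\<^bsub>poly_algebra {1..m}\<^esub> {\<Prod>i\<in>F. var i | F. F \<subseteq> {1..m} \<and> F \<notin> \<Delta>}"

definition var_powers_ideal :: "nat \<Rightarrow> (nat \<Rightarrow> nat) \<Rightarrow> 'k::field mpoly set" where
  "var_powers_ideal m n = Idl\<^bsub>poly_algebra {1..m}\<^esub> {var i ^ n i | i. i \<in> {1..m}}"

definition artinian_ideal :: "nat \<Rightarrow> nat set set \<Rightarrow> (nat \<Rightarrow> nat) \<Rightarrow> 'k::field mpoly set" where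
  "artinian_ideal m \<Delta> n =
     stanley_reisner_ideal m \<Delta> <+>\<^bsub>poly_algebra {1..m}\<^esub> var_powers_ideal m n"

definition quotient_algebra ::
    "('k, 'a, 'y) module_scheme \<Rightarrow> 'a set \<Rightarrow> ('k, 'a set) module" where
  "quotient_algebra R J =
     \<lparr>carrier = carrier (R Quot J), monoid.mult = monoid.mult (R Quot J), one = one (R Quot J),
      zero = zero (R Quot J), add = add (R Quot J),
      module.smult = (\<lambda>c x. (J +>\<^bsub>R\<^esub> (c \<odot>\<^bsub>R\<^esub> \<one>\<^bsub>R\<^esub>)) \<otimes>\<^bsub>R Quot J\<^esub> x)\<rparr>"

definition artinian_SR_algebra ::
    "nat \<Rightarrow> nat set set \<Rightarrow> (nat \<Rightarrow> nat) \<Rightarrow> ('k::field, 'k mpoly set) module" where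
  "artinian_SR_algebra m \<Delta> n = quotient_algebra (poly_algebra {1..m}) (artinian_ideal m \<Delta> n)"

definition artinian_SR_grading ::
    "nat \<Rightarrow> nat set set \<Rightarrow> (nat \<Rightarrow> nat) \<Rightarrow> nat \<Rightarrow> 'k::field mpoly set set" where
  "artinian_SR_grading m \<Delta> n d =
     (\<lambda>p. artinian_ideal m \<Delta> n +>\<^bsub>poly_algebra {1..m}\<^esub> p) ` homogeneous_polys {1..m} d"

section \<open>Well-formedness\<close>

lemma keys_times_subset:
  fixes p q :: "'k::field mpoly"
  assumes "t \<in> Poly_Mapping.keys (p * q)"
  shows "\<exists>u\<in>Poly_Mapping.keys p. \<exists>v\<in>Poly_Mapping.keys q. t = u + v"
  using keys_mult[of p q] assms by blast

lemma cring_poly_algebra: "cring (poly_algebra V :: ('k::field, 'k mpoly) module)"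
proof (rule cringI)
  show "abelian_group (poly_algebra V :: ('k, 'k mpoly) module)"
  proof (rule abelian_groupI)
    fix p :: "'k mpoly" assume "p \<in> carrier (poly_algebra V)"
    then show "\<exists>q\<in>carrier (poly_algebra V). q \<oplus>\<^bsub>poly_algebra V\<^esub> p = \<zero>\<^bsub>poly_algebra V\<^esub>"
      by (intro bexI[of _ "- p"]) (auto simp: poly_algebra_def)
  qed (use Poly_Mapping.keys_add in \<open>fastforce simp: poly_algebra_def add_ac\<close>)+
  show "comm_monoid (poly_algebra V :: ('k, 'k mpoly) module)"
  proof (rule comm_monoidI)
    fix p q :: "'k mpoly"
    assume "p \<in> carrier (poly_algebra V)" "q \<in> carrier (poly_algebra V)"
    then show "p \<otimes>\<^bsub>poly_algebra V\<^esub> q \<in> carrier (poly_algebra V)"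
      using Poly_Mapping.keys_add
      by (fastforce simp: poly_algebra_def dest!: keys_times_subset)
  qed (auto simp: poly_algebra_def mult_ac)
qed (auto simp: poly_algebra_def algebra_simps)

lemma algebra_poly_algebra:
  "algebra ring_of_type_algebra (poly_algebra V :: ('k::field, 'k mpoly) module)"
proof (rule algebraI)
  show "cring (ring_of_type_algebra :: 'k ring)"
    by (rule cring_from_type_algebra)
  show "cring (poly_algebra V :: ('k, 'k mpoly) module)"
    by (rule cring_poly_algebra)
  fix c :: 'k and p :: "'k mpoly"
  assume p: "p \<in> carrier (poly_algebra V)"
  have "Poly_Mapping.single 0 c \<in> carrier (poly_algebra V)"
    by (auto simp: poly_algebra_def)
  then have "Poly_Mapping.single 0 c \<otimes>\<^bsub>poly_algebra V\<^esub> p \<in> carrier (poly_algebra V)"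
    using p by (intro monoid.m_closed cring_poly_algebra ring.is_monoid cring.axioms(1)) auto
  then show "c \<odot>\<^bsub>poly_algebra V\<^esub> p \<in> carrier (poly_algebra V)"
    by (simp add: poly_algebra_def)
qed (simp_all add: poly_algebra_def ring_of_type_algebra_def distrib_right distrib_left single_add
       mult_single flip: mult.assoc)

lemma algebra_quotient_algebra:
  assumes "algebra K R" and "ideal J R"
  shows "algebra K (quotient_algebra R J)"
proof -
  interpret R: algebra K R by fact
  interpret J: ideal J R by fact
  have cR: "cring R" by (rule R.M_cring)
  interpret Q: cring "R Quot J" by (rule J.quotient_is_cring[OF cR])
  let ?Q = "quotient_algebra R J"
  have cQ: "cring ?Q"
  proof (rule cringI)
    show "abelian_group ?Q"
      by (rule abelian_groupI)
        (auto simp: quotient_algebra_def Q.a_ac intro: Q.a_inv_closed Q.l_neg)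
    show "comm_monoid ?Q"
      by (rule comm_monoidI) (auto simp: quotient_algebra_def Q.m_ac)
  qed (auto simp: quotient_algebra_def Q.l_distr)
  define h where "h c = J +>\<^bsub>R\<^esub> (c \<odot>\<^bsub>R\<^esub> \<one>\<^bsub>R\<^esub>)" for c
  have h_in: "h c \<in> carrier (R Quot J)" if "c \<in> carrier K" for c
    using J.rcos_ring_hom that by (auto simp: h_def ring_hom_def)
  have h_add: "h (c \<oplus>\<^bsub>K\<^esub> d) = h c \<oplus>\<^bsub>R Quot J\<^esub> h d"
    if "c \<in> carrier K" "d \<in> carrier K" for c d
    using J.rcos_ring_hom that by (simp add: h_def R.smult_l_distr ring_hom_add)
  have h_mult: "h (c \<otimes>\<^bsub>K\<^esub> d) = h c \<otimes>\<^bsub>R Quot J\<^esub> h d"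
    if "c \<in> carrier K" "d \<in> carrier K" for c d
  proof -
    have "(c \<otimes>\<^bsub>K\<^esub> d) \<odot>\<^bsub>R\<^esub> \<one>\<^bsub>R\<^esub> = (c \<odot>\<^bsub>R\<^esub> \<one>\<^bsub>R\<^esub>) \<otimes>\<^bsub>R\<^esub> (d \<odot>\<^bsub>R\<^esub> \<one>\<^bsub>R\<^esub>)"
      using that by (simp add: R.smult_assoc1 R.smult_assoc2)
    then show ?thesis
      using J.rcos_ring_hom that by (simp add: h_def ring_hom_mult)
  qed
  have h_one: "h \<one>\<^bsub>K\<^esub> = \<one>\<^bsub>R Quot J\<^esub>"
    using J.rcos_ring_hom by (simp add: h_def ring_hom_one)
  have smult: "c \<odot>\<^bsub>?Q\<^esub> x = h c \<otimes>\<^bsub>R Quot J\<^esub> x" for c x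
    by (simp add: quotient_algebra_def h_def)
  have simps: "carrier ?Q = carrier (R Quot J)" "monoid.mult ?Q = monoid.mult (R Quot J)"
    "add ?Q = add (R Quot J)"
    by (simp_all add: quotient_algebra_def)
  show ?thesis
    by (rule algebraI[OF R.R_cring cQ]; unfold smult simps)
      (auto simp: h_in h_add h_mult h_one Q.l_distr Q.r_distr Q.m_assoc)
qed

lemma ideal_artinian_ideal:
  "ideal (artinian_ideal m \<Delta> n :: 'k::field mpoly set) (poly_algebra {1..m})"
proof -
  let ?R = "poly_algebra {1..m} :: ('k, 'k mpoly) module"
  interpret R: cring ?R by (rule cring_poly_algebra)
  have var: "var i \<in> carrier ?R" if "i \<in> {1..m}" for i
    using that by (auto simp: var_def poly_algebra_def)
  have mult: "p * q \<in> carrier ?R" if "p \<in> carrier ?R" "q \<in> carrier ?R" for p q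
    using R.m_closed[OF that] by (simp add: poly_algebra_def)
  have one: "1 \<in> carrier ?R"
    using R.one_closed by (simp add: poly_algebra_def)
  have pow: "var i ^ k \<in> carrier ?R" if "i \<in> {1..m}" for i k
    using that by (induction k) (simp_all only: power_0 power_Suc mult one var)
  have prod: "(\<Prod>i\<in>F. var i) \<in> carrier ?R" if "F \<subseteq> {1..m}" for F
  proof -
    have "finite F" using that finite_subset by blast
    then show ?thesis
      using that
      by (induction F rule: finite_induct)
        (simp_all only: prod.empty prod.insert mult one var insert_subset simp_thms)
  qed
  show ?thesis
    unfolding artinian_ideal_def stanley_reisner_ideal_def var_powers_ideal_def
    by (intro R.add_ideals R.genideal_ideal) (use prod pow in auto)
qed

lemma algebra_artinian_SR_algebra:
  "algebra ring_of_type_algebra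
     (artinian_SR_algebra m \<Delta> n :: ('k::field, 'k mpoly set) module)"
  unfolding artinian_SR_algebra_def
  by (intro algebra_quotient_algebra algebra_poly_algebra ideal_artinian_ideal)

lemma module_regular_module:
  assumes "cring R"
  shows "module R (regular_module R)"
proof -
  interpret R: cring R by fact
  show ?thesis
  proof (rule moduleI[OF assms])
    show "abelian_group (regular_module R)"
      by (rule abelian_groupI)
        (auto simp: regular_module_def R.a_ac intro: R.a_inv_closed R.l_neg)
  qed (auto simp: regular_module_def R.l_distr R.r_distr R.m_assoc)
qed

lemma module_canonical_module:
  assumes "algebra K A"
  shows "module A (canonical_module K A)"
proof -
  interpret A: algebra K A by fact
  let ?W = "canonical_module K A"
  note s = canonical_module_def module_hom_def regular_module_def
  have W_in: "f b \<in> carrier K" if "f \<in> carrier ?W" "b \<in> carrier A" for f b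
    using that by (auto simp: s)
  have W_add: "f (b \<oplus>\<^bsub>A\<^esub> c) = f b \<oplus>\<^bsub>K\<^esub> f c"
    if "f \<in> carrier ?W" "b \<in> carrier A" "c \<in> carrier A" for f b c
    using that by (simp add: s)
  have W_smult: "f (r \<odot>\<^bsub>A\<^esub> b) = r \<otimes>\<^bsub>K\<^esub> f b"
    if "f \<in> carrier ?W" "r \<in> carrier K" "b \<in> carrier A" for f r b
    using that by (simp add: s)
  have W_restrict: "(\<lambda>b\<in>carrier A. f b) = f" if "f \<in> carrier ?W" for f
    using that by (auto simp: s PiE_def extensional_restrict)
  have W_I: "(\<lambda>b\<in>carrier A. g b) \<in> carrier ?W"
    if "\<And>b. b \<in> carrier A \<Longrightarrow> g b \<in> carrier K"
      "\<And>b c. \<lbrakk>b \<in> carrier A; c \<in> carrier A\<rbrakk> \<Longrightarrow> g (b \<oplus>\<^bsub>A\<^esub> c) = g b \<oplus>\<^bsub>K\<^esub> g c"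
      "\<And>r b. \<lbrakk>r \<in> carrier K; b \<in> carrier A\<rbrakk> \<Longrightarrow> g (r \<odot>\<^bsub>A\<^esub> b) = r \<otimes>\<^bsub>K\<^esub> g b" for g
    using that by (simp add: s)
  have add: "f \<oplus>\<^bsub>?W\<^esub> g = (\<lambda>b\<in>carrier A. f b \<oplus>\<^bsub>K\<^esub> g b)" for f g
    by (simp add: s)
  have zero: "\<zero>\<^bsub>?W\<^esub> = (\<lambda>b\<in>carrier A. \<zero>\<^bsub>K\<^esub>)"
    by (simp add: s)
  have smult: "a \<odot>\<^bsub>?W\<^esub> f = (\<lambda>b\<in>carrier A. f (a \<otimes>\<^bsub>A\<^esub> b))" for a f
    by (simp add: s)
  have smult_commute: "a \<otimes>\<^bsub>A\<^esub> (r \<odot>\<^bsub>A\<^esub> b) = r \<odot>\<^bsub>A\<^esub> (a \<otimes>\<^bsub>A\<^esub> b)"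
    if "a \<in> carrier A" "r \<in> carrier K" "b \<in> carrier A" for a r b
    using that A.smult_assoc2[of r b a] by (simp add: A.m_comm)
  show ?thesis
  proof (rule moduleI[OF A.M_cring])
    show "abelian_group ?W"
    proof (rule abelian_groupI)
      fix f assume f: "f \<in> carrier ?W"
      show "\<zero>\<^bsub>?W\<^esub> \<oplus>\<^bsub>?W\<^esub> f = f"
        using W_restrict[OF f] by (simp add: add zero W_in[OF f] cong: restrict_cong)
      show "\<exists>g\<in>carrier ?W. g \<oplus>\<^bsub>?W\<^esub> f = \<zero>\<^bsub>?W\<^esub>"
      proof (rule bexI)
        show "(\<lambda>b\<in>carrier A. \<ominus>\<^bsub>K\<^esub> f b) \<oplus>\<^bsub>?W\<^esub> f = \<zero>\<^bsub>?W\<^esub>"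
          by (simp add: add zero W_in[OF f] A.R.l_neg cong: restrict_cong)
        show "(\<lambda>b\<in>carrier A. \<ominus>\<^bsub>K\<^esub> f b) \<in> carrier ?W"
          by (rule W_I) (simp_all add: W_in[OF f] W_add[OF f] W_smult[OF f]
              A.R.minus_add A.R.r_minus)
      qed
    next
      show "\<zero>\<^bsub>?W\<^esub> \<in> carrier ?W"
        unfolding zero by (rule W_I) simp_all
    next
      fix f g assume f: "f \<in> carrier ?W" and g: "g \<in> carrier ?W"
      show "f \<oplus>\<^bsub>?W\<^esub> g \<in> carrier ?W"
        unfolding add
        by (rule W_I) (simp_all add: W_in[OF f] W_add[OF f] W_smult[OF f] W_in[OF g] W_add[OF g]
            W_smult[OF g] A.R.a_ac A.R.r_distr)
      show "f \<oplus>\<^bsub>?W\<^esub> g = g \<oplus>\<^bsub>?W\<^esub> f"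
        by (simp add: add W_in[OF f] W_in[OF g] A.R.a_comm cong: restrict_cong)
      fix h assume h: "h \<in> carrier ?W"
      show "f \<oplus>\<^bsub>?W\<^esub> g \<oplus>\<^bsub>?W\<^esub> h = f \<oplus>\<^bsub>?W\<^esub> (g \<oplus>\<^bsub>?W\<^esub> h)"
        by (simp add: add W_in[OF f] W_in[OF g] W_in[OF h] A.R.a_assoc cong: restrict_cong)
    qed
  next
    fix a f assume a: "a \<in> carrier A" and f: "f \<in> carrier ?W"
    show "a \<odot>\<^bsub>?W\<^esub> f \<in> carrier ?W"
      unfolding smult
      by (rule W_I) (simp_all add: a W_in[OF f] W_add[OF f] W_smult[OF f] A.r_distr smult_commute)
  next
    fix a b f assume a: "a \<in> carrier A" and b: "b \<in> carrier A" and f: "f \<in> carrier ?W"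
    show "(a \<oplus>\<^bsub>A\<^esub> b) \<odot>\<^bsub>?W\<^esub> f = (a \<odot>\<^bsub>?W\<^esub> f) \<oplus>\<^bsub>?W\<^esub> (b \<odot>\<^bsub>?W\<^esub> f)"
      by (simp add: smult add a b W_add[OF f] A.l_distr cong: restrict_cong)
    show "(a \<otimes>\<^bsub>A\<^esub> b) \<odot>\<^bsub>?W\<^esub> f = a \<odot>\<^bsub>?W\<^esub> (b \<odot>\<^bsub>?W\<^esub> f)"
      by (simp add: smult a b A.m_assoc A.m_lcomm cong: restrict_cong)
  next
    fix a f g assume a: "a \<in> carrier A" and f: "f \<in> carrier ?W" and g: "g \<in> carrier ?W"
    show "a \<odot>\<^bsub>?W\<^esub> (f \<oplus>\<^bsub>?W\<^esub> g) = (a \<odot>\<^bsub>?W\<^esub> f) \<oplus>\<^bsub>?W\<^esub> (a \<odot>\<^bsub>?W\<^esub> g)"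
      by (simp add: smult add a cong: restrict_cong)
  next
    fix f assume f: "f \<in> carrier ?W"
    show "\<one>\<^bsub>A\<^esub> \<odot>\<^bsub>?W\<^esub> f = f"
      using W_restrict[OF f] by (simp add: smult cong: restrict_cong)
  qed
qed

end

theory Submission
  imports Defs
begin

text \<open>
  The monomials \<open>x\<^sup>a\<close> with \<open>supp a \<in> \<Delta>\<close> and \<open>a\<^sub>i < n\<^sub>i\<close> form a basis of \<open>A\<close>, and \<open>\<omega>\<close> has the dual basis
  \<open>e\<^sub>a\<close>, with \<open>x\<^sup>c e\<^sub>a = e\<^bsub>a-c\<^esub>\<close>. If a homomorphism \<open>\<phi>\<close> hits a unit, then \<open>A\<close> is Gorenstein, so here the
  canonical trace is exactly the graded maximal ideal. A nonzero coefficient of \<open>x\<^sub>i\<close> in \<open>\<phi>(\<omega>)\<close> must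
  come from \<open>\<phi>(e\<^sub>\<sigma>)\<close> with \<open>\<sigma>\<close> the top exponent of a facet \<open>F\<close>; as \<open>x\<^sub>j e\<^sub>\<sigma> = 0\<close> for \<open>j \<notin> F\<close>, all neighbours
  of \<open>i\<close> lie in \<open>F\<close>, and \<open>n\<^sub>i = 2\<close> unless \<open>i \<in> F\<close>. If this holds for every vertex, then each connected
  component is either a simplex or the boundary of a simplex with all \<open>n\<^sub>i = 2\<close>.

  Upper bound: \<open>e\<^sub>a \<mapsto> x\<^bsup>d-a\<^esup>\<close> is \<open>A\<close>-linear for \<open>d = \<sigma>\<^sub>C + 1\<^sub>i\<close> with \<open>i\<close> in a simplex component \<open>C\<close>, where it
  hits \<open>x\<^sub>i\<close>, and for \<open>d = 1\<^sub>C\<close> with \<open>C\<close> a boundary component, where it hits all \<open>x\<^sub>i\<close> with \<open>i \<in> C\<close>.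
  Adding up such maps, one vertex per simplex component at a time, exhausts the maximal ideal. Lower bound:
  on the linear forms in the variables of a simplex component \<open>C\<close> with \<open>|C| \<ge> 2\<close>, each homomorphism
  has rank at most one.
\<close>

section \<open>Algebras with a monomial basis\<close>

text \<open>Elements of the quotient are cosets of polynomials, awkward to compute with. The locale
  keeps only coordinates: \<open>cf\<close> identifies \<open>A\<close> with the functions on
  \<open>B\<close>, and products whose exponent leaves \<open>B\<close> vanish.\<close>

locale monomial_algebra =
  fixes A :: "('k::field, 'a) module"
    and B :: "(nat \<Rightarrow>\<^sub>0 nat) set"
    and cf :: "(nat \<Rightarrow>\<^sub>0 nat) \<Rightarrow> 'a \<Rightarrow> 'k"
  assumes algebra: "algebra (ring_of_type_algebra :: 'k ring) A"
    and finite_B: "finite B"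
    and zero_in_B: "0 \<in> B"
    and B_downward: "a + b \<in> B \<Longrightarrow> a \<in> B"
    and cf_eqI: "\<lbrakk>x \<in> carrier A; y \<in> carrier A; \<And>a. a \<in> B \<Longrightarrow> cf a x = cf a y\<rbrakk> \<Longrightarrow> x = y"
    and cf_surj: "\<exists>x\<in>carrier A. \<forall>a\<in>B. cf a x = f a"
    and cf_add: "\<lbrakk>x \<in> carrier A; y \<in> carrier A; a \<in> B\<rbrakk> \<Longrightarrow> cf a (x \<oplus>\<^bsub>A\<^esub> y) = cf a x + cf a y"
    and cf_smult: "\<lbrakk>x \<in> carrier A; a \<in> B\<rbrakk> \<Longrightarrow> cf a (c \<odot>\<^bsub>A\<^esub> x) = c * cf a x"
    and cf_mult: "\<lbrakk>x \<in> carrier A; y \<in> carrier A; a \<in> B\<rbrakk> \<Longrightarrow>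
      cf a (x \<otimes>\<^bsub>A\<^esub> y) = (\<Sum>b\<in>B. \<Sum>c\<in>B. if b + c = a then cf b x * cf c y else 0)"
    and cf_one: "a \<in> B \<Longrightarrow> cf a \<one>\<^bsub>A\<^esub> = (if a = 0 then 1 else 0)"
begin

sublocale algebra "ring_of_type_algebra :: 'k ring" A
  by (rule algebra)

abbreviation W :: "('a, 'a \<Rightarrow> 'k) module" where
  "W \<equiv> canonical_module ring_of_type_algebra A"

abbreviation H :: "(('a \<Rightarrow> 'k) \<Rightarrow> 'a) set" where
  "H \<equiv> canonical_homs ring_of_type_algebra A"

sublocale W: module A W
  by (rule module_canonical_module[OF algebra])

lemma B_downward': "a + b \<in> B \<Longrightarrow> b \<in> B"
  using B_downward by (metis add.commute)

lemma smult_in [simp]: "x \<in> carrier A \<Longrightarrow> c \<odot>\<^bsub>A\<^esub> x \<in> carrier A"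
  using smult_closed[of c x] by (simp add: ring_of_type_algebra_def)

lemma cf_zero: "a \<in> B \<Longrightarrow> cf a \<zero>\<^bsub>A\<^esub> = 0"
  by (metis add_cancel_right_right cf_add r_zero zero_closed)

section \<open>Coordinates, monomials and their products\<close>

definition el :: "((nat \<Rightarrow>\<^sub>0 nat) \<Rightarrow> 'k) \<Rightarrow> 'a" where
  "el f = (SOME x. x \<in> carrier A \<and> (\<forall>a\<in>B. cf a x = f a))"

lemma el_props: "el f \<in> carrier A \<and> (\<forall>a\<in>B. cf a (el f) = f a)"
  unfolding el_def by (rule someI_ex) (use cf_surj[of f] in auto)

lemma el_closed [simp]: "el f \<in> carrier A"
  using el_props by blast

lemma cf_el: "a \<in> B \<Longrightarrow> cf a (el f) = f a"
  using el_props by blast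

text \<open>For \<open>a\<close> outside \<open>B\<close> all coordinates vanish, so
  \<open>mon a\<close> is then zero, as in the quotient.\<close>

definition mon :: "(nat \<Rightarrow>\<^sub>0 nat) \<Rightarrow> 'a" where
  "mon a = el (\<lambda>b. if b = a then 1 else 0)"

lemma mon_closed [simp]: "mon a \<in> carrier A"
  by (simp add: mon_def)

lemma cf_mon: "b \<in> B \<Longrightarrow> cf b (mon a) = (if b = a then 1 else 0)"
  by (simp add: mon_def cf_el)

lemma cf_mult_mon:
  assumes "x \<in> carrier A" "a \<in> B" "c \<in> B"
  shows "cf c (x \<otimes>\<^bsub>A\<^esub> mon a) = (\<Sum>b\<in>B. if a + b = c then cf b x else 0)"
proof -
  have "cf c (x \<otimes>\<^bsub>A\<^esub> mon a) = (\<Sum>b\<in>B. \<Sum>z\<in>B. if z = a then (if a + b = c then cf b x else 0) else 0)"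
    unfolding cf_mult[OF assms(1) mon_closed assms(3)]
    by (intro sum.cong refl) (auto simp: cf_mon add.commute)
  then show ?thesis using assms by (simp add: finite_B)
qed

lemma mon_mult:
  assumes "a + b \<in> B"
  shows "mon a \<otimes>\<^bsub>A\<^esub> mon b = mon (a + b)"
proof (rule cf_eqI)
  fix c assume c: "c \<in> B"
  have ab: "a \<in> B" "b \<in> B"
    using assms B_downward B_downward' by blast+
  have "cf c (mon a \<otimes>\<^bsub>A\<^esub> mon b) = (\<Sum>d\<in>B. if d = a then (if a + b = c then 1 else 0) else 0)"
    unfolding cf_mult_mon[OF mon_closed ab(2) c]
    by (intro sum.cong refl) (auto simp: cf_mon add.commute)
  then show "cf c (mon a \<otimes>\<^bsub>A\<^esub> mon b) = cf c (mon (a + b))"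
    using ab by (simp add: cf_mon c finite_B eq_commute)
qed simp_all

lemma cf_mon_mult:
  assumes "x \<in> carrier A" "a + b \<in> B"
  shows "cf (a + b) (mon a \<otimes>\<^bsub>A\<^esub> x) = cf b x"
proof -
  have ab: "a \<in> B" "b \<in> B"
    using assms B_downward B_downward' by blast+
  then show ?thesis
    using cf_mult_mon[OF assms(1) ab(1) assms(2)] assms(1) by (simp add: m_comm finite_B)
qed

lemma cf_mon_mult_eq_0:
  assumes "x \<in> carrier A" "a \<in> B" "b \<in> B" "\<And>c. a + c \<noteq> b"
  shows "cf b (mon a \<otimes>\<^bsub>A\<^esub> x) = 0"
  using cf_mult_mon[OF assms(1-3)] assms by (simp add: m_comm)

section \<open>The canonical module in the dual basis\<close>

lemma W_closed_iff: "l \<in> carrier W \<longleftrightarrow> l \<in> extensional (carrier A) \<and>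
   (\<forall>x\<in>carrier A. \<forall>y\<in>carrier A. l (x \<oplus>\<^bsub>A\<^esub> y) = l x + l y) \<and>
   (\<forall>c. \<forall>x\<in>carrier A. l (c \<odot>\<^bsub>A\<^esub> x) = c * l x)"
  by (auto simp: canonical_module_def module_hom_def regular_module_def ring_of_type_algebra_def
      PiE_def)

definition lam :: "((nat \<Rightarrow>\<^sub>0 nat) \<Rightarrow> 'k) \<Rightarrow> 'a \<Rightarrow> 'k" where
  "lam f = (\<lambda>x\<in>carrier A. \<Sum>a\<in>B. f a * cf a x)"

lemma lam_apply: "x \<in> carrier A \<Longrightarrow> lam f x = (\<Sum>a\<in>B. f a * cf a x)"
  by (simp add: lam_def)

lemma lam_closed [simp]: "lam f \<in> carrier W"
  unfolding W_closed_iff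
  by (auto simp: lam_def cf_add cf_smult algebra_simps sum.distrib sum_distrib_left)

lemma lam_mon: "a \<in> B \<Longrightarrow> lam f (mon a) = f a"
  by (simp add: lam_apply cf_mon finite_B if_distrib cong: if_cong sum.cong)

lemma lam_cong: "(\<And>a. a \<in> B \<Longrightarrow> f a = g a) \<Longrightarrow> lam f = lam g"
  by (auto simp: lam_def intro!: sum.cong)

lemma W_add: "l \<in> carrier W \<Longrightarrow> x \<in> carrier A \<Longrightarrow> y \<in> carrier A \<Longrightarrow> l (x \<oplus>\<^bsub>A\<^esub> y) = l x + l y"
  by (simp add: W_closed_iff)

lemma W_smult: "l \<in> carrier W \<Longrightarrow> x \<in> carrier A \<Longrightarrow> l (c \<odot>\<^bsub>A\<^esub> x) = c * l x"
  by (simp add: W_closed_iff)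

lemma W_zero: assumes "l \<in> carrier W" shows "l \<zero>\<^bsub>A\<^esub> = 0"
  by (metis add_cancel_right_right assms W_add r_zero zero_closed)

text \<open>Induction on a set \<open>S\<close> carrying the coordinates of \<open>x\<close>: the
  term at \<open>z\<close> is split off, and the rest is carried by a smaller set. The case
  \<open>S = B\<close> is the expansion wanted.\<close>

lemma W_expand_aux:
  assumes "l \<in> carrier W" "finite S" "S \<subseteq> B"
  shows "\<lbrakk>x \<in> carrier A; \<And>a. a \<in> B - S \<Longrightarrow> cf a x = 0\<rbrakk> \<Longrightarrow> l x = (\<Sum>a\<in>S. l (mon a) * cf a x)"
  using assms(2,3)
proof (induction S arbitrary: x rule: finite_induct)
  case empty
  then have "x = \<zero>\<^bsub>A\<^esub>" by (intro cf_eqI) (auto simp: cf_zero)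
  then show ?case using W_zero[OF assms(1)] by simp
next
  case (insert z S)
  define y where "y = el (\<lambda>a. if a = z then 0 else cf a x)"
  have y: "y \<in> carrier A" by (simp add: y_def)
  have "x = y \<oplus>\<^bsub>A\<^esub> cf z x \<odot>\<^bsub>A\<^esub> mon z"
    by (rule cf_eqI) (use insert.prems in \<open>auto simp: cf_add cf_smult y_def cf_el cf_mon\<close>)
  then have "l x = l (y \<oplus>\<^bsub>A\<^esub> cf z x \<odot>\<^bsub>A\<^esub> mon z)" by (rule arg_cong)
  then have "l x = l y + cf z x * l (mon z)"
    by (simp add: W_add[OF assms(1)] W_smult[OF assms(1)] y)
  moreover have "l y = (\<Sum>a\<in>S. l (mon a) * cf a y)"
    using insert.prems by (intro insert.IH) (auto simp: y_def cf_el)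
  moreover have "cf a y = cf a x" if "a \<in> S" for a
  proof -
    have "a \<in> B" "a \<noteq> z" using that insert.hyps insert.prems by auto
    then show ?thesis by (simp add: y_def cf_el)
  qed
  ultimately show ?case using insert.hyps by (simp add: mult.commute)
qed

lemma W_eq_lam:
  assumes "l \<in> carrier W"
  shows "l = lam (\<lambda>a. l (mon a))"
proof
  fix x
  show "l x = lam (\<lambda>a. l (mon a)) x"
  proof (cases "x \<in> carrier A")
    case True
    then show ?thesis
      unfolding lam_apply[OF True] by (intro W_expand_aux[OF assms finite_B order_refl]) auto
  next
    case False
    then show ?thesis using assms by (simp add: W_closed_iff lam_def extensional_def)
  qed
qed

lemma lam_add: "lam f \<oplus>\<^bsub>W\<^esub> lam g = lam (\<lambda>a. f a + g a)"
  by (auto simp: canonical_module_def ring_of_type_algebra_def lam_def distrib_right sum.distrib)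

lemma W_smult_apply: "y \<in> carrier A \<Longrightarrow> (x \<odot>\<^bsub>W\<^esub> l) y = l (x \<otimes>\<^bsub>A\<^esub> y)"
  by (simp add: canonical_module_def)

text \<open>The coordinates of a functional are its values at monomials, so the one at
  \<open>a\<close> is \<open>lam f\<close> evaluated at \<open>x\<close> times \<open>mon a\<close>.
  For a monomial \<open>x\<close> this is the contraction action.\<close>

lemma smult_lam:
  assumes x: "x \<in> carrier A"
  shows "x \<odot>\<^bsub>W\<^esub> lam f = lam (\<lambda>a. \<Sum>b\<in>B. if a + b \<in> B then cf b x * f (a + b) else 0)"
proof -
  have eq: "(x \<odot>\<^bsub>W\<^esub> lam f) (mon a) = (\<Sum>b\<in>B. if a + b \<in> B then cf b x * f (a + b) else 0)"
    if a: "a \<in> B" for a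
  proof -
    have "(x \<odot>\<^bsub>W\<^esub> lam f) (mon a) = (\<Sum>c\<in>B. f c * (\<Sum>b\<in>B. if a + b = c then cf b x else 0))"
      using x a by (simp add: W_smult_apply lam_apply cf_mult_mon)
    also have "\<dots> = (\<Sum>c\<in>B. \<Sum>b\<in>B. if a + b = c then cf b x * f c else 0)"
      by (simp add: sum_distrib_left if_distrib mult.commute cong: if_cong)
    also have "\<dots> = (\<Sum>b\<in>B. \<Sum>c\<in>B. if a + b = c then cf b x * f c else 0)"
      by (rule sum.swap)
    finally show ?thesis by (simp add: finite_B)
  qed
  have "x \<odot>\<^bsub>W\<^esub> lam f \<in> carrier W" using x by simp
  then have "x \<odot>\<^bsub>W\<^esub> lam f = lam (\<lambda>a. (x \<odot>\<^bsub>W\<^esub> lam f) (mon a))" by (rule W_eq_lam)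
  also have "\<dots> = lam (\<lambda>a. \<Sum>b\<in>B. if a + b \<in> B then cf b x * f (a + b) else 0)"
    by (rule lam_cong) (rule eq)
  finally show ?thesis .
qed

text \<open>The vector \<open>e\<^sub>a\<close> of the overview; it is the zero functional for
  \<open>a\<close> outside \<open>B\<close>.\<close>

definition dual :: "(nat \<Rightarrow>\<^sub>0 nat) \<Rightarrow> 'a \<Rightarrow> 'k" where
  "dual a = lam (\<lambda>b. if b = a then 1 else 0)"

lemma dual_closed [simp]: "dual a \<in> carrier W"
  by (simp add: dual_def)

lemma mon_smult_dual:
  assumes "a + b \<in> B"
  shows "mon a \<odot>\<^bsub>W\<^esub> dual (a + b) = dual b"
proof -
  have aB: "a \<in> B" using assms B_downward by blast
  have "(\<Sum>z\<in>B. if c + z \<in> B then cf z (mon a) * (if c + z = a + b then 1 else 0) else 0) =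
      (if c = b then 1 else 0)" if "c \<in> B" for c
  proof -
    have "(\<Sum>z\<in>B. if c + z \<in> B then cf z (mon a) * (if c + z = a + b then 1 else 0) else 0) =
      (\<Sum>z\<in>B. if z = a then (if c = b then 1 else 0) else 0)"
      using assms by (intro sum.cong refl) (auto simp: cf_mon add.commute)
    then show ?thesis using aB by (simp add: finite_B)
  qed
  then show ?thesis
    unfolding dual_def smult_lam[OF mon_closed] by (rule lam_cong)
qed

lemma mon_smult_dual_eq_0:
  assumes "\<And>b. a + b \<noteq> c"
  shows "mon a \<odot>\<^bsub>W\<^esub> dual c = lam (\<lambda>_. 0)"
proof -
  have "(\<Sum>z\<in>B. if d + z \<in> B then cf z (mon a) * (if d + z = c then 1 else 0) else 0) = 0" for d
    using assms[of d] by (intro sum.neutral) (auto simp: cf_mon add.commute)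
  then show ?thesis
    unfolding dual_def smult_lam[OF mon_closed] by (intro lam_cong)
qed

section \<open>Homomorphisms from the canonical module to the algebra\<close>

lemma hom_closed: "\<phi> \<in> H \<Longrightarrow> l \<in> carrier W \<Longrightarrow> \<phi> l \<in> carrier A"
  by (auto simp: module_hom_def regular_module_def)

lemma hom_add: "\<phi> \<in> H \<Longrightarrow> l \<in> carrier W \<Longrightarrow> l' \<in> carrier W \<Longrightarrow> \<phi> (l \<oplus>\<^bsub>W\<^esub> l') = \<phi> l \<oplus>\<^bsub>A\<^esub> \<phi> l'"
  by (simp add: module_hom_def regular_module_def)

lemma hom_smult: "\<phi> \<in> H \<Longrightarrow> x \<in> carrier A \<Longrightarrow> l \<in> carrier W \<Longrightarrow> \<phi> (x \<odot>\<^bsub>W\<^esub> l) = x \<otimes>\<^bsub>A\<^esub> \<phi> l"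
  by (simp add: module_hom_def regular_module_def)

text \<open>Homomorphisms are only required to be \<open>A\<close>-linear. Writing a scalar as an
  element of \<open>A\<close> gives linearity over the field.\<close>

lemma lam_scale: "lam (\<lambda>a. c * f a) = (c \<odot>\<^bsub>A\<^esub> \<one>\<^bsub>A\<^esub>) \<odot>\<^bsub>W\<^esub> lam f"
proof -
  have "(\<Sum>b\<in>B. if a + b \<in> B then cf b (c \<odot>\<^bsub>A\<^esub> \<one>\<^bsub>A\<^esub>) * f (a + b) else 0) = c * f a"
    if "a \<in> B" for a
  proof -
    have "(\<Sum>b\<in>B. if a + b \<in> B then cf b (c \<odot>\<^bsub>A\<^esub> \<one>\<^bsub>A\<^esub>) * f (a + b) else 0) =
      (\<Sum>b\<in>B. if b = 0 then c * f a else 0)"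
      using that by (intro sum.cong refl) (auto simp: cf_smult cf_one)
    then show ?thesis using zero_in_B by (simp add: finite_B)
  qed
  then show ?thesis by (subst smult_lam) (auto intro!: lam_cong)
qed

lemma scalar_mult: "x \<in> carrier A \<Longrightarrow> (c \<odot>\<^bsub>A\<^esub> \<one>\<^bsub>A\<^esub>) \<otimes>\<^bsub>A\<^esub> x = c \<odot>\<^bsub>A\<^esub> x"
  using smult_assoc2[of c "\<one>\<^bsub>A\<^esub>" x] by (simp add: ring_of_type_algebra_def)

lemma hom_lam_zero:
  assumes "\<phi> \<in> H"
  shows "\<phi> (lam (\<lambda>_. 0)) = \<zero>\<^bsub>A\<^esub>"
proof -
  have "\<phi> (lam (\<lambda>_. 0)) = \<phi> (lam (\<lambda>_. 0)) \<oplus>\<^bsub>A\<^esub> \<phi> (lam (\<lambda>_. 0))"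
    using hom_add[OF assms, of "lam (\<lambda>_. 0)" "lam (\<lambda>_. 0)"] by (simp add: lam_add)
  then show ?thesis
    using hom_closed[OF assms lam_closed] by (metis add.r_cancel_one')
qed

lemma cf_hom_aux:
  assumes "\<phi> \<in> H" "finite S" "S \<subseteq> B" "b \<in> B"
  shows "(\<And>a. a \<in> B - S \<Longrightarrow> f a = 0) \<Longrightarrow> cf b (\<phi> (lam f)) = (\<Sum>a\<in>S. f a * cf b (\<phi> (dual a)))"
  using assms(2,3)
proof (induction S arbitrary: f rule: finite_induct)
  case empty
  then have "lam f = lam (\<lambda>_. 0)" by (intro lam_cong) auto
  then show ?case using hom_lam_zero[OF assms(1)] cf_zero assms(4) by simp
next
  case (insert z S)
  define g where "g = f(z := 0)"
  have "lam f = lam g \<oplus>\<^bsub>W\<^esub> lam (\<lambda>a. f z * (if a = z then 1 else 0))"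
    unfolding lam_add by (rule lam_cong) (simp add: g_def)
  then have "lam f = lam g \<oplus>\<^bsub>W\<^esub> ((f z \<odot>\<^bsub>A\<^esub> \<one>\<^bsub>A\<^esub>) \<odot>\<^bsub>W\<^esub> dual z)"
    by (simp only: lam_scale dual_def)
  then have "\<phi> (lam f) = \<phi> (lam g) \<oplus>\<^bsub>A\<^esub> f z \<odot>\<^bsub>A\<^esub> \<phi> (dual z)"
    by (simp add: hom_add[OF assms(1)] hom_smult[OF assms(1)] scalar_mult hom_closed[OF assms(1)])
  then have "cf b (\<phi> (lam f)) = cf b (\<phi> (lam g)) + f z * cf b (\<phi> (dual z))"
    by (simp add: cf_add cf_smult assms(4) hom_closed[OF assms(1)])
  moreover have "cf b (\<phi> (lam g)) = (\<Sum>a\<in>S. g a * cf b (\<phi> (dual a)))"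
    using insert.prems by (intro insert.IH) (auto simp: g_def)
  moreover have "\<dots> = (\<Sum>a\<in>S. f a * cf b (\<phi> (dual a)))"
    using insert.hyps by (intro sum.cong) (auto simp: g_def)
  ultimately show ?case using insert.hyps by simp
qed

text \<open>The matrix of \<open>\<phi>\<close> in the dual basis and the monomial basis. Questions
  about coefficients in the image thus reduce to the vectors \<open>dual a\<close>.\<close>

lemma cf_hom:
  assumes "\<phi> \<in> H" "l \<in> carrier W" "b \<in> B"
  shows "cf b (\<phi> l) = (\<Sum>a\<in>B. l (mon a) * cf b (\<phi> (dual a)))"
  using cf_hom_aux[OF assms(1) finite_B order_refl assms(3), of "\<lambda>a. l (mon a)"]
  by (simp flip: W_eq_lam[OF assms(2)])

text \<open>The homomorphism of degree \<open>d\<close> sends the dual of \<open>x\<^sup>a\<close> to \<open>x\<^bsup>d-a\<^esup>\<close>; admissibility of \<open>d\<close> is what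
  makes it \<open>A\<close>-linear.\<close>

definition admissible :: "(nat \<Rightarrow>\<^sub>0 nat) \<Rightarrow> bool" where
  "admissible d \<longleftrightarrow>
     (\<forall>a\<in>B. \<forall>b\<in>B. \<forall>c. a + b = d \<longrightarrow> a + c \<in> B \<longrightarrow> (\<exists>e. b = c + e))"

text \<open>A whole set of degrees is summed, so that one homomorphism can serve several components
  at once. The condition \<open>a + b = d\<close> avoids the truncated difference
  \<open>d - a\<close>; where no such \<open>b\<close> lies in \<open>B\<close>, the image is
  zero.\<close>

definition complement_hom :: "(nat \<Rightarrow>\<^sub>0 nat) set \<Rightarrow> ('a \<Rightarrow> 'k) \<Rightarrow> 'a" where
  "complement_hom D =
     (\<lambda>l\<in>carrier W. el (\<lambda>b. \<Sum>d\<in>D. \<Sum>a\<in>B. if a + b = d then l (mon a) else 0))"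

text \<open>Both sides are the coefficient of \<open>x\<^sup>b\<close>: on the left in the image of
  \<open>x\<^sup>c\<close> times the functional, on the right in \<open>x\<^sup>c\<close> times its
  image.\<close>

lemma complement_hom_linear_aux:
  assumes "admissible d" "b \<in> B" "c \<in> B"
  shows "(\<Sum>a\<in>B. if a + b = d \<and> a + c \<in> B then f (a + c) else 0) =
    (\<Sum>b'\<in>B. if c + b' = b then (\<Sum>a'\<in>B. if a' + b' = d then f a' else (0::'k)) else 0)"
proof (cases "\<exists>a\<in>B. a + b = d \<and> a + c \<in> B")
  case True
  then obtain a where a: "a \<in> B" "a + b = d" "a + c \<in> B" by blast
  \<comment> \<open>Admissibility makes \<open>x\<^sup>c\<close> divide \<open>x\<^sup>b\<close>, so
    each side has one surviving term: at \<open>a\<close> on the left, at the pair \<open>e\<close>,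
    \<open>a + c\<close> on the right.\<close>
  then obtain e where e: "b = c + e"
    using assms unfolding admissible_def by blast
  have eB: "e \<in> B" using assms(2) e B_downward' by blast
  have d: "d = a + c + e" using a(2) e by (simp add: add.assoc)
  have cancel: "c + b' = b \<longleftrightarrow> b' = e" "a' + e = d \<longleftrightarrow> a' = a + c" for a' b'
    by (simp_all only: e d add_left_cancel add_right_cancel)
  have "(\<Sum>z\<in>B. if z + b = d \<and> z + c \<in> B then f (z + c) else 0) =
      (\<Sum>z\<in>B. if z = a then f (a + c) else 0)"
    using a by (intro sum.cong refl) auto
  moreover have "(\<Sum>b'\<in>B. if c + b' = b then (\<Sum>a'\<in>B. if a' + b' = d then f a' else 0) else 0) =
      (\<Sum>b'\<in>B. if b' = e then (\<Sum>a'\<in>B. if a' = a + c then f a' else 0) else 0)"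
    by (intro sum.cong refl) (simp add: cancel)
  ultimately show ?thesis using a eB by (simp add: finite_B)
next
  case False
  have "a' + b' \<noteq> d" if ab: "b' \<in> B" "a' \<in> B" "c + b' = b" for a' b'
  proof
    assume d: "a' + b' = d"
    then have "b' + a' = d" "b' + c \<in> B" using ab assms(2) by (simp_all add: add.commute)
    \<comment> \<open>Admissibility with the two summands of \<open>d\<close> exchanged: a surviving
      term on the right would produce one on the left.\<close>
    then obtain e where e: "a' = c + e"
      using assms(1) ab unfolding admissible_def by blast
    then have "e \<in> B" "e + b = d" "e + c \<in> B"
      using ab d B_downward' by (auto simp: add_ac)
    then show False using False by blast
  qed
  then have "(\<Sum>b'\<in>B. if c + b' = b then (\<Sum>a'\<in>B. if a' + b' = d then f a' else 0) else 0) = 0"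
    by (intro sum.neutral) auto
  moreover have "(\<Sum>a\<in>B. if a + b = d \<and> a + c \<in> B then f (a + c) else 0) = 0"
    using False by (intro sum.neutral) auto
  ultimately show ?thesis by simp
qed

lemma cf_complement_hom:
  assumes "b \<in> B"
  shows "cf b (complement_hom D (lam f)) = (\<Sum>d\<in>D. \<Sum>a\<in>B. if a + b = d then f a else 0)"
  using assms by (simp add: complement_hom_def cf_el lam_mon cong: sum.cong if_cong)

text \<open>Expanding \<open>x\<close> in its coordinates and exchanging sums reduces
  \<open>A\<close>-linearity to one degree and one monomial at a time, which is
  \<open>complement_hom_linear_aux\<close>.\<close>

lemma complement_hom_in:
  assumes "\<forall>d\<in>D. admissible d"
  shows "complement_hom D \<in> H"
proof -
  have cl: "complement_hom D l \<in> carrier A" if "l \<in> carrier W" for l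
    using that by (simp add: complement_hom_def)
  have "complement_hom D (lam f \<oplus>\<^bsub>W\<^esub> lam g) = complement_hom D (lam f) \<oplus>\<^bsub>A\<^esub> complement_hom D (lam g)" for f g
  proof (rule cf_eqI)
    fix b assume b: "b \<in> B"
    have "(\<Sum>a\<in>B. if a + b = d then f a + g a else 0) =
        (\<Sum>a\<in>B. if a + b = d then f a else 0) + (\<Sum>a\<in>B. if a + b = d then g a else 0)" for d
      by (auto simp flip: sum.distrib intro!: sum.cong)
    then show "cf b (complement_hom D (lam f \<oplus>\<^bsub>W\<^esub> lam g)) =
        cf b (complement_hom D (lam f) \<oplus>\<^bsub>A\<^esub> complement_hom D (lam g))"
      by (simp add: lam_add cf_add cl cf_complement_hom b sum.distrib)
  qed (simp_all add: cl)
  moreover have "complement_hom D (x \<odot>\<^bsub>W\<^esub> lam f) = x \<otimes>\<^bsub>A\<^esub> complement_hom D (lam f)" if x: "x \<in> carrier A" for x f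
  proof (rule cf_eqI)
    fix b assume b: "b \<in> B"
    have "cf b (complement_hom D (x \<odot>\<^bsub>W\<^esub> lam f)) =
      (\<Sum>d\<in>D. \<Sum>a\<in>B. \<Sum>c\<in>B. cf c x * (if a + b = d \<and> a + c \<in> B then f (a + c) else 0))"
      unfolding smult_lam[OF x] cf_complement_hom[OF b]
      by (intro sum.cong refl) (auto intro!: sum.cong)
    also have "\<dots> = (\<Sum>d\<in>D. \<Sum>c\<in>B. \<Sum>a\<in>B. cf c x * (if a + b = d \<and> a + c \<in> B then f (a + c) else 0))"
      by (intro sum.cong refl sum.swap)
    also have "\<dots> = (\<Sum>d\<in>D. \<Sum>c\<in>B. cf c x *
        (\<Sum>b'\<in>B. if c + b' = b then (\<Sum>a'\<in>B. if a' + b' = d then f a' else 0) else 0))"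
      by (intro sum.cong refl)
        (simp add: complement_hom_linear_aux[OF assms[rule_format] b] flip: sum_distrib_left)
    also have "\<dots> = (\<Sum>c\<in>B. \<Sum>d\<in>D. cf c x *
        (\<Sum>b'\<in>B. if c + b' = b then (\<Sum>a'\<in>B. if a' + b' = d then f a' else 0) else 0))"
      by (rule sum.swap)
    also have "\<dots> = (\<Sum>c\<in>B. \<Sum>d\<in>D. \<Sum>b'\<in>B.
        if c + b' = b then cf c x * (\<Sum>a'\<in>B. if a' + b' = d then f a' else 0) else 0)"
      by (intro sum.cong refl, subst sum_distrib_left, intro sum.cong refl) simp
    also have "\<dots> = (\<Sum>c\<in>B. \<Sum>b'\<in>B. \<Sum>d\<in>D.
        if c + b' = b then cf c x * (\<Sum>a'\<in>B. if a' + b' = d then f a' else 0) else 0)"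
      by (intro sum.cong refl sum.swap)
    also have "\<dots> = (\<Sum>c\<in>B. \<Sum>b'\<in>B. if c + b' = b then
        cf c x * cf b' (complement_hom D (lam f)) else 0)"
      by (intro sum.cong refl) (auto simp: cf_complement_hom sum_distrib_left)
    also have "\<dots> = cf b (x \<otimes>\<^bsub>A\<^esub> complement_hom D (lam f))"
      by (simp add: cf_mult[OF x cl[OF lam_closed] b])
    finally show "cf b (complement_hom D (x \<odot>\<^bsub>W\<^esub> lam f)) = cf b (x \<otimes>\<^bsub>A\<^esub> complement_hom D (lam f))" .
  qed (simp_all add: cl x)
  ultimately have
    "\<forall>l\<in>carrier W. \<forall>l'\<in>carrier W. complement_hom D (l \<oplus>\<^bsub>W\<^esub> l') = complement_hom D l \<oplus>\<^bsub>A\<^esub> complement_hom D l'"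
    "\<forall>x\<in>carrier A. \<forall>l\<in>carrier W. complement_hom D (x \<odot>\<^bsub>W\<^esub> l) = x \<otimes>\<^bsub>A\<^esub> complement_hom D l"
    using W_eq_lam by metis+
  then show ?thesis
    using cl by (auto simp: module_hom_def regular_module_def complement_hom_def)
qed

end

lemma nonzero_exponent_split:
  assumes "b \<noteq> (0 :: nat \<Rightarrow>\<^sub>0 nat)"
  obtains c j where "b = c + Poly_Mapping.single j 1"
proof -
  obtain j where j: "Poly_Mapping.lookup b j \<noteq> 0"
    using assms by (metis lookup_zero poly_mapping_eqI)
  have "b = (b - Poly_Mapping.single j 1) + Poly_Mapping.single j 1"
    using j by (intro poly_mapping_eqI) (auto simp: lookup_add lookup_minus lookup_single when_def)
  then show ?thesis by (rule that)
qed

context monomial_algebra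
begin

section \<open>The maximal ideal, the socle and the Gorenstein property\<close>

lemma cf_finsum:
  assumes "finite J" "\<And>j. j \<in> J \<Longrightarrow> f j \<in> carrier A" "b \<in> B"
  shows "cf b (finsum A f J) = (\<Sum>j\<in>J. cf b (f j))"
  using assms(1,2)
proof (induction J rule: finite_induct)
  case empty
  then show ?case by (simp add: cf_zero assms(3))
next
  case (insert j J)
  then have "finsum A f J \<in> carrier A" "finsum A f (insert j J) = f j \<oplus>\<^bsub>A\<^esub> finsum A f J"
    by (auto intro!: finsum_closed finsum_insert)
  then show ?case using insert by (simp add: cf_add assms(3))
qed

text \<open>An exponent with the largest number of divisors works, since a proper multiple inside
  \<open>B\<close> would have more.\<close>

lemma exists_maximal_exponent: "\<exists>t\<in>B. \<forall>c. t + c \<in> B \<longrightarrow> c = 0"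
proof -
  define below where "below t = {b \<in> B. \<exists>c. b + c = t}" for t
  have "Max ((\<lambda>t. card (below t)) ` B) \<in> (\<lambda>t. card (below t)) ` B"
    using finite_B zero_in_B by (intro Max_in) auto
  then obtain t where "t \<in> B" "card (below t) = Max ((\<lambda>t. card (below t)) ` B)" by auto
  then have t: "t \<in> B" "\<And>u. u \<in> B \<Longrightarrow> card (below u) \<le> card (below t)"
    using finite_B by simp_all
  have "c = 0" if c: "t + c \<in> B" for c
  proof (rule ccontr)
    assume "c \<noteq> 0"
    have "t + c + d \<noteq> t" for d
    proof
      assume "t + c + d = t"
      then have "c + d = 0" by (metis add.assoc add_cancel_right_right)
      then have "Poly_Mapping.lookup c k = 0" for k
        by (metis add_is_0 lookup_add lookup_zero)
      with \<open>c \<noteq> 0\<close> show False by (metis lookup_zero poly_mapping_eqI)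
    qed
    then have "t + c \<notin> below t" "t + c \<in> below (t + c)"
      using c by (auto simp: below_def intro: exI[of _ 0])
    moreover have "below t \<subseteq> below (t + c)"
      unfolding below_def by (auto intro: add.assoc[symmetric])
    ultimately have "below t \<subset> below (t + c)" by blast
    then have "card (below t) < card (below (t + c))"
      by (intro psubset_card_mono) (auto simp: below_def finite_B)
    then show False using t(2)[OF c] by simp
  qed
  then show ?thesis using t(1) by blast
qed

text \<open>The graded maximal ideal in coordinates, without reference to a grading;
  \<open>graded_maximal_ideal_Q\<close> identifies the two.\<close>

definition maxideal :: "'a set" where
  "maxideal = {x \<in> carrier A. cf 0 x = 0}"

lemma mult_smult:
  assumes "y \<in> carrier A" "w \<in> carrier A"
  shows "y \<otimes>\<^bsub>A\<^esub> (c \<odot>\<^bsub>A\<^esub> w) = c \<odot>\<^bsub>A\<^esub> (y \<otimes>\<^bsub>A\<^esub> w)"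
proof -
  have "y \<otimes>\<^bsub>A\<^esub> ((c \<odot>\<^bsub>A\<^esub> \<one>\<^bsub>A\<^esub>) \<otimes>\<^bsub>A\<^esub> w) = (c \<odot>\<^bsub>A\<^esub> \<one>\<^bsub>A\<^esub>) \<otimes>\<^bsub>A\<^esub> (y \<otimes>\<^bsub>A\<^esub> w)"
    using assms by (simp add: m_lcomm)
  then show ?thesis
    using assms by (simp only: scalar_mult m_closed)
qed

lemma smult_zero: "c \<odot>\<^bsub>A\<^esub> \<zero>\<^bsub>A\<^esub> = \<zero>\<^bsub>A\<^esub>"
  by (rule smult_r_null) (simp add: ring_of_type_algebra_def)

text \<open>Subtracting its constant term moves \<open>y\<close> into the maximal ideal, which kills
  \<open>z\<close>.\<close>

lemma socle_mult:
  assumes gr: "graded_maximal_ideal A gr = maxideal"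
    and z: "z \<in> socle A gr" and y: "y \<in> carrier A"
  shows "y \<otimes>\<^bsub>A\<^esub> z = cf 0 y \<odot>\<^bsub>A\<^esub> z"
proof -
  have zA: "z \<in> carrier A" using z by (simp add: socle_def)
  let ?y = "y \<oplus>\<^bsub>A\<^esub> (- cf 0 y) \<odot>\<^bsub>A\<^esub> \<one>\<^bsub>A\<^esub>"
  have "?y \<in> maxideal"
    using y by (simp add: maxideal_def cf_add cf_smult cf_one zero_in_B)
  then have "?y \<otimes>\<^bsub>A\<^esub> z = \<zero>\<^bsub>A\<^esub>" using z by (simp add: socle_def gr)
  then have eq: "y \<otimes>\<^bsub>A\<^esub> z \<oplus>\<^bsub>A\<^esub> (- cf 0 y) \<odot>\<^bsub>A\<^esub> z = \<zero>\<^bsub>A\<^esub>"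
    using y zA by (simp add: l_distr scalar_mult)
  show ?thesis
  proof (rule cf_eqI)
    fix a assume a: "a \<in> B"
    have "cf a (y \<otimes>\<^bsub>A\<^esub> z \<oplus>\<^bsub>A\<^esub> (- cf 0 y) \<odot>\<^bsub>A\<^esub> z) = 0"
      using eq a by (simp add: cf_zero)
    then show "cf a (y \<otimes>\<^bsub>A\<^esub> z) = cf a (cf 0 y \<odot>\<^bsub>A\<^esub> z)"
      using y zA a by (simp add: cf_add cf_smult)
  qed (use y zA in auto)
qed

text \<open>The functional \<open>l\<close> is injective on the socle, which is therefore one-dimensional.\<close>

lemma gorenstein_if_hom_hits_unit:
  assumes gr: "graded_maximal_ideal A gr = maxideal"
    and \<phi>: "\<phi> \<in> H" and l: "l \<in> carrier W" and unit: "cf 0 (\<phi> l) \<noteq> 0"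
  shows "gorenstein ring_of_type_algebra A gr"
proof -
  note sm = socle_mult[OF gr]
  have soc_in: "z \<in> carrier A" if "z \<in> socle A gr" for z
    using that by (simp add: socle_def)
  \<comment> \<open>All multiples of a socle element \<open>z\<close> are scalar multiples, so
    \<open>l z = 0\<close> means that \<open>z\<close> annihilates \<open>l\<close>. Then
    \<open>z\<close> annihilates \<open>\<phi> l\<close>, which acts on \<open>z\<close> as its
    nonzero constant term.\<close>
  have inj: "z = \<zero>\<^bsub>A\<^esub>" if z: "z \<in> socle A gr" and lz: "l z = 0" for z
  proof -
    have zA: "z \<in> carrier A" by (rule soc_in[OF z])
    have "(z \<odot>\<^bsub>W\<^esub> l) (mon a) = 0" for a
      using sm[OF z, of "mon a"] zA lz by (simp add: W_smult_apply m_comm W_smult[OF l])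
    then have "z \<odot>\<^bsub>W\<^esub> l = lam (\<lambda>_. 0)"
      using W_eq_lam[of "z \<odot>\<^bsub>W\<^esub> l"] zA l by simp
    then have "z \<otimes>\<^bsub>A\<^esub> \<phi> l = \<zero>\<^bsub>A\<^esub>"
      using hom_smult[OF \<phi> zA l] hom_lam_zero[OF \<phi>] by simp
    then have "cf 0 (\<phi> l) \<odot>\<^bsub>A\<^esub> z = \<zero>\<^bsub>A\<^esub>"
      using sm[OF z hom_closed[OF \<phi> l]] zA hom_closed[OF \<phi> l] by (simp add: m_comm)
    then have "cf 0 (\<phi> l) * cf a z = 0" if "a \<in> B" for a
      using cf_smult[OF zA that, of "cf 0 (\<phi> l)"] that by (simp add: cf_zero)
    then show ?thesis using unit zA by (intro cf_eqI) (auto simp: cf_zero)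
  qed
  \<comment> \<open>The socle is nonzero: it contains the monomial of a maximal exponent.\<close>
  obtain t where t: "t \<in> B" "\<And>c. t + c \<in> B \<Longrightarrow> c = 0"
    using exists_maximal_exponent by blast
  let ?s = "mon t"
  have s0: "?s \<noteq> \<zero>\<^bsub>A\<^esub>"
    using cf_mon[OF t(1), of t] cf_zero[OF t(1)] by auto
  have s: "?s \<in> socle A gr"
  proof -
    have "y \<otimes>\<^bsub>A\<^esub> ?s = \<zero>\<^bsub>A\<^esub>" if y: "y \<in> maxideal" for y
    proof (rule cf_eqI)
      fix c assume c: "c \<in> B"
      have "cf c (y \<otimes>\<^bsub>A\<^esub> ?s) = (\<Sum>b\<in>B. if t + b = c then cf b y else 0)"
        using y c t(1) by (intro cf_mult_mon) (auto simp: maxideal_def)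
      also have "\<dots> = 0"
        using y c t(2) by (intro sum.neutral) (auto simp: maxideal_def)
      finally show "cf c (y \<otimes>\<^bsub>A\<^esub> ?s) = cf c \<zero>\<^bsub>A\<^esub>" using c by (simp add: cf_zero)
    qed (use y in \<open>auto simp: maxideal_def\<close>)
    then show ?thesis by (simp add: socle_def gr)
  qed
  have ls: "l ?s \<noteq> 0" using inj[OF s] s0 by blast
  have multiple: "z = (l z / l ?s) \<odot>\<^bsub>A\<^esub> ?s" if z: "z \<in> socle A gr" for z
  proof -
    have zA: "z \<in> carrier A" by (rule soc_in[OF z])
    \<comment> \<open>The combination of \<open>z\<close> and \<open>?s\<close> that lies in the
      kernel of \<open>l\<close>.\<close>
    let ?z = "l ?s \<odot>\<^bsub>A\<^esub> z \<oplus>\<^bsub>A\<^esub> (- l z) \<odot>\<^bsub>A\<^esub> ?s"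
    have "?z \<in> socle A gr"
    proof -
      have "y \<otimes>\<^bsub>A\<^esub> ?z = \<zero>\<^bsub>A\<^esub>" if y: "y \<in> maxideal" for y
      proof (rule cf_eqI)
        have yA: "y \<in> carrier A" using y by (simp add: maxideal_def)
        fix a assume a: "a \<in> B"
        have "y \<otimes>\<^bsub>A\<^esub> (c \<odot>\<^bsub>A\<^esub> w) = \<zero>\<^bsub>A\<^esub>" if w: "w \<in> socle A gr" for c w
        proof -
          have "y \<otimes>\<^bsub>A\<^esub> w = \<zero>\<^bsub>A\<^esub>" using w y by (simp add: socle_def gr)
          then show ?thesis using mult_smult[OF yA soc_in[OF w]] by (simp add: smult_zero)
        qed
        then have "y \<otimes>\<^bsub>A\<^esub> ?z = \<zero>\<^bsub>A\<^esub>" using yA zA z s by (simp add: r_distr)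
        then show "cf a (y \<otimes>\<^bsub>A\<^esub> ?z) = cf a \<zero>\<^bsub>A\<^esub>" by simp
      qed (use y zA in \<open>auto simp: maxideal_def\<close>)
      then show ?thesis using zA by (simp add: socle_def gr)
    qed
    moreover have "l ?z = 0"
      using zA by (simp add: W_add[OF l] W_smult[OF l])
    ultimately have "?z = \<zero>\<^bsub>A\<^esub>" by (rule inj)
    then have eq: "cf a ?z = 0" if "a \<in> B" for a using that by (simp add: cf_zero)
    show ?thesis
    proof (rule cf_eqI)
      fix a assume a: "a \<in> B"
      show "cf a z = cf a ((l z / l ?s) \<odot>\<^bsub>A\<^esub> ?s)"
        using eq[OF a] ls a zA by (simp add: cf_add cf_smult field_simps)
    qed (use zA in auto)
  qed
  have smult_soc: "c \<odot>\<^bsub>A\<^esub> ?s \<in> socle A gr" for c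
  proof -
    have "y \<otimes>\<^bsub>A\<^esub> (c \<odot>\<^bsub>A\<^esub> ?s) = \<zero>\<^bsub>A\<^esub>" if y: "y \<in> maxideal" for y
    proof -
      have yA: "y \<in> carrier A" using y by (simp add: maxideal_def)
      have "y \<otimes>\<^bsub>A\<^esub> ?s = \<zero>\<^bsub>A\<^esub>" using s y by (simp add: socle_def gr)
      then show ?thesis using mult_smult[OF yA mon_closed] by (simp add: smult_zero)
    qed
    then show ?thesis by (simp add: socle_def gr)
  qed
  let ?K = "(\<lambda>c. c \<odot>\<^bsub>A\<^esub> \<one>\<^bsub>A\<^esub>) ` carrier (ring_of_type_algebra :: 'k ring)"
  \<comment> \<open>Dimension one is certified by extending the zero subspace by the line through
    \<open>?s\<close>.\<close>
  have "line_extension ?K ?s {\<zero>\<^bsub>A\<^esub>} = socle A gr"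
  proof (intro Set.set_eqI iffI)
    fix z assume "z \<in> line_extension ?K ?s {\<zero>\<^bsub>A\<^esub>}"
    then show "z \<in> socle A gr"
      using smult_soc by (auto simp: line_extension_mem_iff scalar_mult)
  next
    fix z assume z: "z \<in> socle A gr"
    then have "z = ((l z / l ?s) \<odot>\<^bsub>A\<^esub> \<one>\<^bsub>A\<^esub>) \<otimes>\<^bsub>A\<^esub> ?s \<oplus>\<^bsub>A\<^esub> \<zero>\<^bsub>A\<^esub>"
      using multiple[OF z] soc_in[OF z] by (simp add: scalar_mult)
    then show "z \<in> line_extension ?K ?s {\<zero>\<^bsub>A\<^esub>}"
      unfolding line_extension_mem_iff by (auto simp: ring_of_type_algebra_def)
  qed
  moreover have "dimension (Suc 0) ?K (line_extension ?K ?s {\<zero>\<^bsub>A\<^esub>})"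
    using s0 by (intro Suc_dim) auto
  ultimately show ?thesis by (simp add: gorenstein_def)
qed

section \<open>Ideals generated by images of homomorphisms\<close>

lemma hom_images_closed:
  assumes "\<And>i. i \<in> I \<Longrightarrow> \<psi> i \<in> H" "J \<subseteq> I" "\<forall>j\<in>J. a j \<in> \<psi> j ` carrier W"
  shows "a \<in> J \<rightarrow> carrier A"
proof (rule Pi_I)
  fix j assume j: "j \<in> J"
  then obtain l where l: "l \<in> carrier W" "a j = \<psi> j l" using assms(3) by blast
  then show "a j \<in> carrier A" using hom_closed[OF assms(1) l(1)] assms(2) j by auto
qed

lemma family_sum_homs_closed:
  assumes "\<And>i. i \<in> I \<Longrightarrow> \<psi> i \<in> H" "x \<in> family_sum A (\<lambda>i. \<psi> i ` carrier W) I"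
  shows "x \<in> carrier A"
proof -
  obtain a J where J: "x = finsum A a J" "J \<subseteq> I" "\<forall>j\<in>J. a j \<in> \<psi> j ` carrier W"
    using assms(2) unfolding family_sum_def by blast
  have "a \<in> J \<rightarrow> carrier A" by (rule hom_images_closed[OF assms(1) J(2,3)])
  then show ?thesis using J(1) by (simp add: finsum_closed)
qed

lemma cf_family_sum_homs:
  assumes "\<And>i. i \<in> I \<Longrightarrow> \<psi> i \<in> H" "x \<in> family_sum A (\<lambda>i. \<psi> i ` carrier W) I"
  obtains J l where "finite J" "J \<subseteq> I" "\<And>j. l j \<in> carrier W"
    "\<And>b. b \<in> B \<Longrightarrow> cf b x = (\<Sum>j\<in>J. cf b (\<psi> j (l j)))"
proof -
  obtain a J where J: "x = finsum A a J" "finite J" "J \<subseteq> I" "\<forall>j\<in>J. a j \<in> \<psi> j ` carrier W"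
    using assms(2) unfolding family_sum_def by blast
  have "\<forall>j\<in>J. \<exists>l. l \<in> carrier W \<and> a j = \<psi> j l" using J(4) by auto
  then obtain l where l: "\<And>j. j \<in> J \<Longrightarrow> l j \<in> carrier W" "\<And>j. j \<in> J \<Longrightarrow> a j = \<psi> j (l j)"
    by (auto dest!: bchoice)
  \<comment> \<open>A default value outside \<open>J\<close> makes every \<open>?l j\<close> a
    member of \<open>W\<close>.\<close>
  let ?l = "\<lambda>j. if j \<in> J then l j else dual 0"
  have "a j \<in> carrier A" if "j \<in> J" for j
    using hom_images_closed[OF assms(1) J(3,4)] that by blast
  then have "cf b x = (\<Sum>j\<in>J. cf b (\<psi> j (?l j)))" if "b \<in> B" for b
    using J l that by (simp add: cf_finsum)
  moreover have "?l j \<in> carrier W" for j using l by auto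
  ultimately show ?thesis using that[of J ?l] J by blast
qed

lemma family_sum_homs_incl:
  assumes "\<And>i. i \<in> I \<Longrightarrow> \<psi> i \<in> H" "i \<in> I" "l \<in> carrier W"
  shows "\<psi> i l \<in> family_sum A (\<lambda>i. \<psi> i ` carrier W) I"
proof -
  have "\<psi> i l = finsum A (\<lambda>_. \<psi> i l) {i}"
    using hom_closed[OF assms(1)[OF assms(2)] assms(3)] by simp
  then show ?thesis unfolding family_sum_def using assms by blast
qed

lemma zero_in_family_sum: "\<zero>\<^bsub>A\<^esub> \<in> family_sum A U I"
proof -
  have "\<zero>\<^bsub>A\<^esub> = finsum A (\<lambda>_. \<zero>\<^bsub>A\<^esub>) {}" by simp
  then show ?thesis unfolding family_sum_def by blast
qed

lemma family_sum_homs_mult: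
  assumes "\<And>i. i \<in> I \<Longrightarrow> \<psi> i \<in> H" "x \<in> family_sum A (\<lambda>i. \<psi> i ` carrier W) I" "y \<in> carrier A"
  shows "y \<otimes>\<^bsub>A\<^esub> x \<in> family_sum A (\<lambda>i. \<psi> i ` carrier W) I"
proof -
  obtain a J where J: "x = finsum A a J" "finite J" "J \<subseteq> I" "\<forall>j\<in>J. a j \<in> \<psi> j ` carrier W"
    using assms(2) unfolding family_sum_def by blast
  have "a \<in> J \<rightarrow> carrier A" by (rule hom_images_closed[OF assms(1) J(3,4)])
  then have "y \<otimes>\<^bsub>A\<^esub> x = finsum A (\<lambda>j. y \<otimes>\<^bsub>A\<^esub> a j) J"
    using J assms(3) by (simp add: finsum_rdistr)
  moreover have "y \<otimes>\<^bsub>A\<^esub> a j \<in> \<psi> j ` carrier W" if j: "j \<in> J" for j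
  proof -
    obtain l where "l \<in> carrier W" "a j = \<psi> j l" using J j by blast
    then have "y \<otimes>\<^bsub>A\<^esub> a j = \<psi> j (y \<odot>\<^bsub>W\<^esub> l)" "y \<odot>\<^bsub>W\<^esub> l \<in> carrier W"
      using hom_smult assms j J by auto
    then show ?thesis by blast
  qed
  ultimately show ?thesis unfolding family_sum_def using J by blast
qed

text \<open>The two elements may use different finite index sets. Padding both families of
  functionals by zero on the union allows them to be added inside each
  \<open>\<psi> j\<close>.\<close>

lemma family_sum_homs_add:
  assumes \<psi>: "\<And>i. i \<in> I \<Longrightarrow> \<psi> i \<in> H"
    and x: "x \<in> family_sum A (\<lambda>i. \<psi> i ` carrier W) I"
    and y: "y \<in> family_sum A (\<lambda>i. \<psi> i ` carrier W) I"
  shows "x \<oplus>\<^bsub>A\<^esub> y \<in> family_sum A (\<lambda>i. \<psi> i ` carrier W) I"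
proof -
  obtain J l where J: "finite J" "J \<subseteq> I" "\<And>j. l j \<in> carrier W"
    "\<And>b. b \<in> B \<Longrightarrow> cf b x = (\<Sum>j\<in>J. cf b (\<psi> j (l j)))"
    using cf_family_sum_homs[OF \<psi> x] by blast
  obtain J' l' where J': "finite J'" "J' \<subseteq> I" "\<And>j. l' j \<in> carrier W"
    "\<And>b. b \<in> B \<Longrightarrow> cf b y = (\<Sum>j\<in>J'. cf b (\<psi> j (l' j)))"
    using cf_family_sum_homs[OF \<psi> y] by blast
  define L where "L j = (if j \<in> J then l j else lam (\<lambda>_. 0))" for j
  define L' where "L' j = (if j \<in> J' then l' j else lam (\<lambda>_. 0))" for j
  have L: "L j \<in> carrier W" "L' j \<in> carrier W" for j
    by (simp_all add: L_def L'_def J(3) J'(3))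
  have hL: "\<psi> j (L j) \<in> carrier A" "\<psi> j (L' j) \<in> carrier A" if "j \<in> J \<union> J'" for j
    using that J(2) J'(2) \<psi> L hom_closed by blast+
  have zero: "cf b (\<psi> j (lam (\<lambda>_. 0))) = 0" if "j \<in> J \<union> J'" "b \<in> B" for j b
    using that J(2) J'(2) hom_lam_zero[OF \<psi>, of j] by (auto simp: cf_zero)
  have "x \<oplus>\<^bsub>A\<^esub> y = finsum A (\<lambda>j. \<psi> j (L j) \<oplus>\<^bsub>A\<^esub> \<psi> j (L' j)) (J \<union> J')"
  proof (rule cf_eqI)
    fix b assume b: "b \<in> B"
    have "cf b (finsum A (\<lambda>j. \<psi> j (L j) \<oplus>\<^bsub>A\<^esub> \<psi> j (L' j)) (J \<union> J')) =
        (\<Sum>j\<in>J \<union> J'. cf b (\<psi> j (L j) \<oplus>\<^bsub>A\<^esub> \<psi> j (L' j)))"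
      using J(1) J'(1) hL b by (intro cf_finsum) auto
    also have "\<dots> = (\<Sum>j\<in>J \<union> J'. cf b (\<psi> j (L j)) + cf b (\<psi> j (L' j)))"
      using hL b by (intro sum.cong refl cf_add) auto
    also have "\<dots> = (\<Sum>j\<in>J \<union> J'. cf b (\<psi> j (L j))) + (\<Sum>j\<in>J \<union> J'. cf b (\<psi> j (L' j)))"
      by (rule sum.distrib)
    also have "(\<Sum>j\<in>J \<union> J'. cf b (\<psi> j (L j))) = (\<Sum>j\<in>J. cf b (\<psi> j (l j)))"
      using J(1) J'(1) zero b by (intro sum.mono_neutral_cong_right) (auto simp: L_def)
    also have "(\<Sum>j\<in>J \<union> J'. cf b (\<psi> j (L' j))) = (\<Sum>j\<in>J'. cf b (\<psi> j (l' j)))"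
      using J(1) J'(1) zero b by (intro sum.mono_neutral_cong_right) (auto simp: L'_def)
    finally show "cf b (x \<oplus>\<^bsub>A\<^esub> y) = cf b (finsum A (\<lambda>j. \<psi> j (L j) \<oplus>\<^bsub>A\<^esub> \<psi> j (L' j)) (J \<union> J'))"
      using b J(4) J'(4) family_sum_homs_closed[OF \<psi> x] family_sum_homs_closed[OF \<psi> y]
      by (simp add: cf_add)
  next
    show "x \<oplus>\<^bsub>A\<^esub> y \<in> carrier A"
      using family_sum_homs_closed[OF \<psi> x] family_sum_homs_closed[OF \<psi> y] by simp
    show "finsum A (\<lambda>j. \<psi> j (L j) \<oplus>\<^bsub>A\<^esub> \<psi> j (L' j)) (J \<union> J') \<in> carrier A"
      using hL by (intro finsum_closed) auto
  qed
  moreover have "\<psi> j (L j) \<oplus>\<^bsub>A\<^esub> \<psi> j (L' j) \<in> \<psi> j ` carrier W" if "j \<in> J \<union> J'" for j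
  proof -
    have "\<psi> j (L j) \<oplus>\<^bsub>A\<^esub> \<psi> j (L' j) = \<psi> j (L j \<oplus>\<^bsub>W\<^esub> L' j)"
      using that J(2) J'(2) by (intro hom_add[symmetric] \<psi> L) auto
    then show ?thesis using L by simp
  qed
  ultimately show ?thesis
    unfolding family_sum_def using J(1,2) J'(1,2)
    by (intro CollectI exI[of _ "\<lambda>j. \<psi> j (L j) \<oplus>\<^bsub>A\<^esub> \<psi> j (L' j)"] exI[of _ "J \<union> J'"] conjI) auto
qed

text \<open>The sum of the images is an ideal. Containing the variables, it contains all nonconstant
  monomials and their combinations; \<open>nonunit\<close> gives the other inclusion.\<close>

lemma family_sum_homs_eq_maxideal:
  assumes \<psi>: "\<And>i. i \<in> I \<Longrightarrow> \<psi> i \<in> H"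
    and nonunit: "\<And>\<phi> l. \<phi> \<in> H \<Longrightarrow> l \<in> carrier W \<Longrightarrow> cf 0 (\<phi> l) = 0"
    and vars: "\<And>j. Poly_Mapping.single j 1 \<in> B \<Longrightarrow>
      mon (Poly_Mapping.single j 1) \<in> family_sum A (\<lambda>i. \<psi> i ` carrier W) I"
  shows "family_sum A (\<lambda>i. \<psi> i ` carrier W) I = maxideal"
proof -
  let ?U = "family_sum A (\<lambda>i. \<psi> i ` carrier W) I"
  have mon: "mon b \<in> ?U" if b: "b \<in> B" "b \<noteq> 0" for b
  proof -
    obtain c j where cj: "b = c + Poly_Mapping.single j 1"
      using nonzero_exponent_split[OF b(2)] by blast
    then have "mon b = mon c \<otimes>\<^bsub>A\<^esub> mon (Poly_Mapping.single j 1)"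
      using b mon_mult by simp
    moreover have "Poly_Mapping.single j 1 \<in> B" using b cj B_downward' by blast
    ultimately show ?thesis using family_sum_homs_mult[OF \<psi> vars] by simp
  qed
  have fs: "finsum A f S \<in> ?U" if "finite S" "\<And>b. b \<in> S \<Longrightarrow> f b \<in> ?U" for f :: "_ \<Rightarrow> 'a" and S :: "(nat \<Rightarrow>\<^sub>0 nat) set"
    using that
  proof (induction S rule: finite_induct)
    case empty
    then show ?case by (simp add: zero_in_family_sum)
  next
    case (insert b S)
    then have "finsum A f (insert b S) = f b \<oplus>\<^bsub>A\<^esub> finsum A f S"
      using family_sum_homs_closed[of I \<psi>, OF \<psi>] by (intro finsum_insert) blast+
    then show ?case using insert family_sum_homs_add[of I \<psi>, OF \<psi>] by simp
  qed
  show ?thesis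
  proof (intro Set.set_eqI iffI)
    fix x assume x: "x \<in> ?U"
    obtain J l where J: "finite J" "J \<subseteq> I" "\<And>j. l j \<in> carrier W"
      "\<And>b. b \<in> B \<Longrightarrow> cf b x = (\<Sum>j\<in>J. cf b (\<psi> j (l j)))"
      using cf_family_sum_homs[OF \<psi> x] by blast
    have "cf 0 x = 0"
      unfolding J(4)[OF zero_in_B] using J(2,3) nonunit \<psi> by (intro sum.neutral) blast
    then show "x \<in> maxideal"
      using family_sum_homs_closed[OF \<psi> x] by (simp add: maxideal_def)
  next
    fix x assume x: "x \<in> maxideal"
    then have xA: "x \<in> carrier A" by (simp add: maxideal_def)
    have "x = finsum A (\<lambda>b. cf b x \<odot>\<^bsub>A\<^esub> mon b) (B - {0})"
    proof (rule cf_eqI)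
      fix c assume c: "c \<in> B"
      have "cf c (finsum A (\<lambda>b. cf b x \<odot>\<^bsub>A\<^esub> mon b) (B - {0})) =
          (\<Sum>b\<in>B - {0}. cf c (cf b x \<odot>\<^bsub>A\<^esub> mon b))"
        using c finite_B by (intro cf_finsum) auto
      also have "\<dots> = (\<Sum>b\<in>B - {0}. if c = b then cf b x else 0)"
        using c by (intro sum.cong refl) (simp add: cf_smult cf_mon)
      also have "\<dots> = cf c x"
        using x c finite_B by (auto simp: maxideal_def)
      finally show "cf c x = cf c (finsum A (\<lambda>b. cf b x \<odot>\<^bsub>A\<^esub> mon b) (B - {0}))" ..
    qed (use xA in \<open>auto intro!: finsum_closed\<close>)
    moreover have "cf b x \<odot>\<^bsub>A\<^esub> mon b \<in> ?U" if "b \<in> B - {0}" for b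
    proof -
      have "(cf b x \<odot>\<^bsub>A\<^esub> \<one>\<^bsub>A\<^esub>) \<otimes>\<^bsub>A\<^esub> mon b \<in> ?U"
        using that by (intro family_sum_homs_mult[OF \<psi>] mon) auto
      then show ?thesis by (simp add: scalar_mult)
    qed
    ultimately show "x \<in> ?U" using fs[of "B - {0}" "\<lambda>b. cf b x \<odot>\<^bsub>A\<^esub> mon b"] finite_B by simp
  qed
qed

text \<open>The trace is the sum over all homomorphisms, so the previous lemma applies to the family
  \<open>H\<close> indexed by itself.\<close>

lemma canonical_trace_eq_maxideal:
  assumes "\<And>\<phi> l. \<phi> \<in> H \<Longrightarrow> l \<in> carrier W \<Longrightarrow> cf 0 (\<phi> l) = 0"
    and "maxideal \<subseteq> canonical_trace ring_of_type_algebra A"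
  shows "canonical_trace ring_of_type_algebra A = maxideal"
  unfolding canonical_trace_def
proof (rule family_sum_homs_eq_maxideal)
  fix j assume j: "Poly_Mapping.single j (1::nat) \<in> B"
  have "Poly_Mapping.single j (1::nat) \<noteq> 0" by (metis lookup_single_eq lookup_zero zero_neq_one)
  then have "mon (Poly_Mapping.single j 1) \<in> maxideal"
    by (simp add: maxideal_def cf_mon zero_in_B)
  then show "mon (Poly_Mapping.single j 1) \<in> family_sum A (\<lambda>\<phi>. \<phi> ` carrier W) H"
    using assms(2) unfolding canonical_trace_def by blast
qed (use assms in auto)

end

section \<open>Components of the complex\<close>

text \<open>The closed neighbourhood: \<open>j = i\<close> is included for a vertex, as
  \<open>{i, i} = {i}\<close>. Under the trace conditions it turns out to be the whole component of
  \<open>i\<close>.\<close>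

definition neighbours :: "'v set set \<Rightarrow> 'v \<Rightarrow> 'v set" where
  "neighbours \<Delta> i = {j. {i, j} \<in> \<Delta>}"

locale ghost_free_complex =
  fixes V :: "'v set" and \<Delta> :: "'v set set"
  assumes complex: "simplicial_complex V \<Delta>" and finite_V: "finite V"
    and no_ghost: "\<forall>i\<in>V. \<not> ghost_vertex \<Delta> i"
begin

lemma face_subset: "F \<in> \<Delta> \<Longrightarrow> G \<subseteq> F \<Longrightarrow> G \<in> \<Delta>"
  using complex by (auto simp: simplicial_complex_def)

lemma face_in_V: "F \<in> \<Delta> \<Longrightarrow> F \<subseteq> V"
  using complex by (auto simp: simplicial_complex_def)

lemma vertex_face: "i \<in> V \<longleftrightarrow> {i} \<in> \<Delta>"
  using no_ghost face_in_V by (auto simp: ghost_vertex_def)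

lemma neighbours_in_V: "neighbours \<Delta> i \<subseteq> V"
  using face_in_V by (auto simp: neighbours_def)

lemma neighbours_self: "i \<in> V \<Longrightarrow> i \<in> neighbours \<Delta> i"
  by (simp add: neighbours_def vertex_face)

lemma neighbours_sym: "j \<in> neighbours \<Delta> i \<longleftrightarrow> i \<in> neighbours \<Delta> j"
  by (simp add: neighbours_def insert_commute)

lemma face_subset_neighbours: "F \<in> \<Delta> \<Longrightarrow> i \<in> F \<Longrightarrow> F \<subseteq> neighbours \<Delta> i"
  using face_subset by (auto simp: neighbours_def)

lemma finite_neighbours: "finite (neighbours \<Delta> i)"
  using neighbours_in_V finite_V finite_subset by metis

text \<open>Maximality is tested one vertex at a time, the form in which it arises from exponents;
  \<open>facet_maximal\<close> recovers maximality under inclusion.\<close>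

definition facet :: "'v set \<Rightarrow> bool" where
  "facet F \<longleftrightarrow> F \<in> \<Delta> \<and> (\<forall>j\<in>V - F. insert j F \<notin> \<Delta>)"

lemma facet_maximal: "facet F \<Longrightarrow> G \<in> \<Delta> \<Longrightarrow> F \<subseteq> G \<Longrightarrow> G = F"
proof (rule ccontr)
  assume F: "facet F" and G: "G \<in> \<Delta>" "F \<subseteq> G" "G \<noteq> F"
  then obtain j where j: "j \<in> G" "j \<notin> F" by blast
  then have "insert j F \<in> \<Delta>" "j \<in> V" using face_subset[OF G(1)] face_in_V[OF G(1)] G(2) by auto
  then show False using F j by (auto simp: facet_def)
qed

text \<open>The necessary condition imposed on the vertex \<open>i\<close> by \<open>x\<^sub>i\<close> lying in the canonical trace.\<close>

definition trace_condition :: "('v \<Rightarrow> nat) \<Rightarrow> 'v \<Rightarrow> bool" where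
  "trace_condition n i \<longleftrightarrow>
     (\<exists>F. facet F \<and> (i \<notin> F \<longrightarrow> n i = 2) \<and> neighbours \<Delta> i - {i} \<subseteq> F)"

text \<open>For a vertex in \<open>V\<close> this says that it lies in exactly one facet.\<close>

definition simplicial_vertex :: "'v \<Rightarrow> bool" where
  "simplicial_vertex i \<longleftrightarrow> facet (neighbours \<Delta> i)"

lemma facet_eq_neighbours:
  assumes "facet F" "i \<in> F" "neighbours \<Delta> i - {i} \<subseteq> F"
  shows "neighbours \<Delta> i = F"
  using assms face_subset_neighbours[of F i] by (auto simp: facet_def)

section \<open>Complexes all of whose vertices satisfy the trace condition\<close>

context
  fixes n :: "'v \<Rightarrow> nat"
  assumes cond: "\<forall>i\<in>V. trace_condition n i"
begin

text \<open>If the facet from the trace condition contained \<open>i\<close>, it would equal the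
  neighbourhood of \<open>i\<close>, making \<open>i\<close> simplicial.\<close>

lemma nonsimplicial_witness:
  assumes "i \<in> V" "\<not> simplicial_vertex i"
  obtains F where "facet F" "i \<notin> F" "n i = 2" "neighbours \<Delta> i - {i} \<subseteq> F"
  using assms cond facet_eq_neighbours unfolding trace_condition_def simplicial_vertex_def by metis

text \<open>A neighbour \<open>j\<close> distinct from \<open>i\<close> lies in the facet
  \<open>F\<close> that avoids \<open>i\<close>. Were \<open>j\<close> simplicial, maximality would
  force its neighbourhood to be \<open>F\<close>, which misses the neighbour
  \<open>i\<close>.\<close>

lemma nonsimplicial_spreads:
  assumes i: "i \<in> V" "\<not> simplicial_vertex i" and j: "j \<in> neighbours \<Delta> i"
  shows "\<not> simplicial_vertex j"
proof (cases "j = i")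
  case True
  then show ?thesis using i by simp
next
  case False
  obtain F where F: "facet F" "i \<notin> F" "neighbours \<Delta> i - {i} \<subseteq> F"
    using nonsimplicial_witness[OF i] by metis
  have "j \<in> F" using j F False by auto
  show ?thesis
  proof
    assume s: "simplicial_vertex j"
    have "F \<subseteq> neighbours \<Delta> j"
      using F(1) \<open>j \<in> F\<close> by (intro face_subset_neighbours) (auto simp: facet_def)
    then have "neighbours \<Delta> j = F"
      using facet_maximal[OF F(1)] s by (auto simp: simplicial_vertex_def facet_def)
    then show False using j F(2) neighbours_sym by metis
  qed
qed

text \<open>It remains to see that every vertex of the witness \<open>F\<close> is adjacent to
  \<open>i\<close>. This comes from the witness of a second vertex \<open>j\<close>, a neighbour of
  \<open>i\<close>.\<close>

lemma nonsimplicial_neighbours: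
  assumes i: "i \<in> V" "\<not> simplicial_vertex i"
  obtains F where "facet F" "i \<notin> F" "n i = 2" "neighbours \<Delta> i = insert i F"
proof -
  obtain F where F: "facet F" "i \<notin> F" "n i = 2" "neighbours \<Delta> i - {i} \<subseteq> F"
    using nonsimplicial_witness[OF i] by metis
  \<comment> \<open>An isolated vertex is itself a facet and hence simplicial.\<close>
  have "\<exists>j. j \<in> neighbours \<Delta> i - {i}"
  proof (rule ccontr)
    assume "\<not> ?thesis"
    then have eq: "neighbours \<Delta> i = {i}" using neighbours_self[OF i(1)] by auto
    have "facet {i}"
      using i(1) eq unfolding facet_def vertex_face by (auto simp: neighbours_def insert_commute)
    then show False using i(2) eq by (simp add: simplicial_vertex_def)
  qed
  then obtain j where j: "j \<in> neighbours \<Delta> i" "j \<noteq> i" by blast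
  have jV: "j \<in> V" using j neighbours_in_V by auto
  \<comment> \<open>The facet \<open>G\<close> contains all neighbours of \<open>j\<close> other
    than \<open>j\<close>, in particular \<open>i\<close> and \<open>F - {j}\<close>, so these are
    adjacent to \<open>i\<close>.\<close>
  obtain G where G: "facet G" "neighbours \<Delta> j - {j} \<subseteq> G"
    using nonsimplicial_witness[OF jV nonsimplicial_spreads[OF i j(1)]] by metis
  have "i \<in> G" using G(2) j neighbours_sym by auto
  have "j \<in> F" using j F(4) by auto
  then have "F - {j} \<subseteq> G" using F(1) G(2) face_subset_neighbours[of F j] by (auto simp: facet_def)
  moreover have "G \<subseteq> neighbours \<Delta> i"
    using G(1) \<open>i \<in> G\<close> by (intro face_subset_neighbours) (auto simp: facet_def)
  ultimately have "F \<subseteq> neighbours \<Delta> i" using j by auto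
  then have "neighbours \<Delta> i = insert i F" using F(4) neighbours_self[OF i(1)] by auto
  then show ?thesis using that F by blast
qed

text \<open>The neighbourhood of \<open>k\<close> is \<open>k\<close> together with a facet; for
  \<open>k\<close> distinct from \<open>i\<close> that facet contains \<open>i\<close>, so its
  vertices are neighbours of \<open>i\<close>.\<close>

lemma nonsimplicial_neighbours_subset:
  assumes i: "i \<in> V" "\<not> simplicial_vertex i" and k: "k \<in> neighbours \<Delta> i"
  shows "neighbours \<Delta> k \<subseteq> neighbours \<Delta> i"
proof (cases "k = i")
  case False
  have kV: "k \<in> V" using k neighbours_in_V by auto
  obtain G where G: "facet G" "neighbours \<Delta> k = insert k G"
    using nonsimplicial_neighbours[OF kV nonsimplicial_spreads[OF i k]] by metis
  have "i \<in> G" using G k neighbours_sym False by (metis insertE)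
  then show ?thesis using G k face_subset_neighbours[of G i] by (auto simp: facet_def)
qed simp

text \<open>Adjacency is transitive. In the simplicial case two facets are compared by maximality;
  otherwise the inclusion just shown is used in both directions.\<close>

lemma component_eq:
  assumes i: "i \<in> V" and k: "k \<in> neighbours \<Delta> i"
  shows "neighbours \<Delta> k = neighbours \<Delta> i"
proof -
  have kV: "k \<in> V" using k neighbours_in_V by auto
  have ik: "i \<in> neighbours \<Delta> k" using k neighbours_sym by metis
  show ?thesis
  proof (cases "simplicial_vertex i")
    case True
    then have "simplicial_vertex k" using nonsimplicial_spreads[OF kV _ ik] by blast
    with True have f: "facet (neighbours \<Delta> i)" "facet (neighbours \<Delta> k)"
      by (simp_all add: simplicial_vertex_def)
    then have "neighbours \<Delta> i \<subseteq> neighbours \<Delta> k"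
      using k by (intro face_subset_neighbours) (auto simp: facet_def)
    then show ?thesis using facet_maximal f by (auto simp: facet_def)
  next
    case False
    then show ?thesis
      using nonsimplicial_neighbours_subset[OF i False k]
        nonsimplicial_neighbours_subset[OF kV nonsimplicial_spreads[OF i False k] ik] by blast
  qed
qed

text \<open>No vertex of such a component is simplicial, and the facet avoiding \<open>k\<close> is
  the component without \<open>k\<close>. As \<open>k\<close> varies, this describes the boundary of
  a simplex.\<close>

lemma nonsimplex_component:
  assumes i: "i \<in> V" and "neighbours \<Delta> i \<notin> \<Delta>" and k: "k \<in> neighbours \<Delta> i"
  shows "neighbours \<Delta> i - {k} \<in> \<Delta> \<and> n k = 2"
proof -
  have kV: "k \<in> V" using k neighbours_in_V by auto
  have "\<not> simplicial_vertex k"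
    using assms component_eq[OF i k] by (auto simp: simplicial_vertex_def facet_def)
  then obtain F where F: "facet F" "k \<notin> F" "n k = 2" "neighbours \<Delta> k = insert k F"
    using nonsimplicial_neighbours[OF kV] by metis
  then have "neighbours \<Delta> i - {k} = F" using component_eq[OF i k] by auto
  then show ?thesis using F by (simp add: facet_def)
qed

text \<open>Neighbourhoods are constant along edges, so everything reachable by a path is already
  adjacent.\<close>

lemma skeleton_components_eq: "skeleton_components V \<Delta> = neighbours \<Delta> ` V"
proof -
  have V: "skeleton_vertices V \<Delta> = V" using no_ghost by (auto simp: skeleton_vertices_def)
  have "((skeleton_adj \<Delta>)\<^sup>* \<inter> V \<times> V) `` {i} = neighbours \<Delta> i" if i: "i \<in> V" for i
  proof (intro Set.set_eqI iffI)
    fix j assume "j \<in> ((skeleton_adj \<Delta>)\<^sup>* \<inter> V \<times> V) `` {i}"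
    then have "(i, j) \<in> (skeleton_adj \<Delta>)\<^sup>*" by auto
    then show "j \<in> neighbours \<Delta> i"
    proof (induction rule: rtrancl_induct)
      case base
      then show ?case by (rule neighbours_self[OF i])
    next
      case (step j k)
      then have "k \<in> neighbours \<Delta> j" by (simp add: skeleton_adj_def neighbours_def)
      then show ?case using component_eq[OF i step.IH] by simp
    qed
  next
    fix j assume j: "j \<in> neighbours \<Delta> i"
    then have "(i, j) \<in> (skeleton_adj \<Delta>)\<^sup>*"
      by (cases "i = j") (auto simp: skeleton_adj_def neighbours_def)
    then show "j \<in> ((skeleton_adj \<Delta>)\<^sup>* \<inter> V \<times> V) `` {i}" using i j neighbours_in_V by auto
  qed
  then show ?thesis unfolding skeleton_components_def V quotient_def by auto
qed

lemma simplex_components_eq: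
  "simplex_components V \<Delta> = {neighbours \<Delta> i | i. i \<in> V \<and> neighbours \<Delta> i \<in> \<Delta>}"
  unfolding simplex_components_def skeleton_components_eq restrict_complex_def
  using face_subset by blast

end

end

text \<open>The unit vectors of the space with coordinates in \<open>C\<close> lie in the span of
  \<open>card J\<close> vectors. Finitely supported functions supply a vector space type for the
  dimension argument.\<close>

lemma unit_vectors_bound:
  fixes v :: "'j \<Rightarrow> 'i \<Rightarrow> 'k::field"
  assumes J: "finite J" and C: "finite C"
    and repr: "\<And>i. i \<in> C \<Longrightarrow> \<exists>c. \<forall>i'\<in>C. (if i' = i then 1 else 0) = (\<Sum>j\<in>J. c j * v j i')"
  shows "card C \<le> card J"
proof -
  define scale :: "'k \<Rightarrow> ('i \<Rightarrow>\<^sub>0 'k) \<Rightarrow> ('i \<Rightarrow>\<^sub>0 'k)" where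
    "scale c = Poly_Mapping.map ((*) c)" for c
  have lookup_scale: "Poly_Mapping.lookup (scale c p) i = c * Poly_Mapping.lookup p i" for c p i
    by (simp add: scale_def map.rep_eq when_def)
  interpret vector_space scale
    by unfold_locales
      (auto intro!: poly_mapping_eqI simp: lookup_scale lookup_add algebra_simps)
  define E :: "'i \<Rightarrow> 'i \<Rightarrow>\<^sub>0 'k" where "E i = Poly_Mapping.single i 1" for i
  \<comment> \<open>The vector \<open>v j\<close> is cut off outside \<open>C\<close>, since
    \<open>repr\<close> controls only coordinates in \<open>C\<close>.\<close>
  define u where "u j = (\<Sum>i\<in>C. Poly_Mapping.single i (v j i))" for j
  have lookup_u: "Poly_Mapping.lookup (u j) i = (if i \<in> C then v j i else 0)" for i j
    using C by (simp add: u_def lookup_sum lookup_single when_def)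
  have inj: "inj_on E C"
    by (auto simp: inj_on_def E_def) (metis lookup_single_eq lookup_single_not_eq zero_neq_one)
  have "E i \<in> span (u ` J)" if i: "i \<in> C" for i
  proof -
    obtain c where c: "\<forall>i'\<in>C. (if i' = i then 1 else 0) = (\<Sum>j\<in>J. c j * v j i')"
      using repr[OF i] by blast
    have "E i = (\<Sum>j\<in>J. scale (c j) (u j))"
    proof (rule poly_mapping_eqI)
      fix k
      show "Poly_Mapping.lookup (E i) k = Poly_Mapping.lookup (\<Sum>j\<in>J. scale (c j) (u j)) k"
        using c i by (cases "k \<in> C")
          (auto simp: E_def lookup_sum lookup_scale lookup_u lookup_single when_def)
    qed
    then show ?thesis by (simp add: span_sum span_scale span_base)
  qed
  moreover have "independent (E ` C)"
    unfolding dependent_finite[OF finite_imageI[OF C]]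
  proof clarify
    fix f i assume sum0: "(\<Sum>x\<in>E ` C. scale (f x) x) = 0" and i: "i \<in> C" "f (E i) \<noteq> 0"
    have "0 = Poly_Mapping.lookup (\<Sum>i\<in>C. scale (f (E i)) (E i)) i"
      using sum0 by (simp add: sum.reindex[OF inj] o_def)
    also have "\<dots> = f (E i)"
      using C i by (simp add: lookup_sum lookup_scale E_def lookup_single when_def if_distrib cong: if_cong)
    finally show False using i by simp
  qed
  ultimately have "card (E ` C) \<le> card (u ` J)"
    using independent_span_bound[of "u ` J" "E ` C"] J by auto
  then show ?thesis
    using card_image[OF inj] card_image_le[OF J, of u] by linarith
qed

section \<open>Teter number of monomial algebras of complexes\<close>

text \<open>The exponents of the monomials outside the defining ideal; they index the basis of the
  quotient.\<close>

definition standard_exponents :: "nat set set \<Rightarrow> (nat \<Rightarrow> nat) \<Rightarrow> (nat \<Rightarrow>\<^sub>0 nat) set" where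
  "standard_exponents \<Delta> n =
     {a. Poly_Mapping.keys a \<in> \<Delta> \<and> (\<forall>i\<in>Poly_Mapping.keys a. Poly_Mapping.lookup a i < n i)}"

abbreviation unit_exp :: "nat \<Rightarrow> (nat \<Rightarrow>\<^sub>0 nat)" where
  "unit_exp i \<equiv> Poly_Mapping.single i 1"

text \<open>For a face \<open>F\<close> this is the largest standard exponent supported on
  \<open>F\<close>, written \<open>\<sigma>\<close> in the overview.\<close>

definition top_exp :: "(nat \<Rightarrow> nat) \<Rightarrow> nat set \<Rightarrow> (nat \<Rightarrow>\<^sub>0 nat)" where
  "top_exp n F = (\<Sum>i\<in>F. Poly_Mapping.single i (n i - 1))"

lemma lookup_top_exp:
  "finite F \<Longrightarrow> Poly_Mapping.lookup (top_exp n F) i = (if i \<in> F then n i - 1 else 0)"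
  by (simp add: top_exp_def lookup_sum lookup_single when_def)

lemma keys_add_nat: "Poly_Mapping.keys (a + b) = Poly_Mapping.keys a \<union> Poly_Mapping.keys (b :: 'v \<Rightarrow>\<^sub>0 nat)"
  by (auto simp: in_keys_iff lookup_add)

lemma single_inj: "Poly_Mapping.single i (1::nat) = Poly_Mapping.single j 1 \<longleftrightarrow> i = j"
  by (metis lookup_single_eq lookup_single_not_eq zero_neq_one)

lemma unit_exp_neq_0: "unit_exp i \<noteq> 0"
  by (metis lookup_single_eq lookup_zero zero_neq_one)

lemma unit_exp_add_neq: "j \<noteq> i \<Longrightarrow> unit_exp j + c \<noteq> unit_exp i"
proof
  assume "j \<noteq> i" "unit_exp j + c = unit_exp i"
  then have "Poly_Mapping.lookup (unit_exp j + c) j = 0" by (simp add: lookup_single)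
  then show False by (simp add: lookup_add)
qed

locale artinian_SR = monomial_algebra A "standard_exponents \<Delta> n" cf + ghost_free_complex V \<Delta>
  for A :: "('k::field, 'a) module" and V :: "nat set" and \<Delta> :: "nat set set"
    and n :: "nat \<Rightarrow> nat" and cf +
  assumes n_ge_2: "\<And>i. i \<in> V \<Longrightarrow> n i \<ge> 2"
begin

abbreviation B :: "(nat \<Rightarrow>\<^sub>0 nat) set" where
  "B \<equiv> standard_exponents \<Delta> n"

lemma B_iff: "a \<in> B \<longleftrightarrow> Poly_Mapping.keys a \<in> \<Delta> \<and> (\<forall>i\<in>V. Poly_Mapping.lookup a i < n i)"
proof -
  have "Poly_Mapping.lookup a i < n i" if "i \<in> V" "i \<notin> Poly_Mapping.keys a" for i
    using that n_ge_2[of i] by (simp add: in_keys_iff)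
  then show ?thesis using face_in_V by (auto simp: standard_exponents_def)
qed

lemma n_bounds: "i \<in> V \<Longrightarrow> 0 < n i \<and> Suc 0 < n i"
  using n_ge_2[of i] by auto

lemma unit_exp_in_B: "unit_exp i \<in> B \<longleftrightarrow> i \<in> V"
  using vertex_face n_bounds by (auto simp: B_iff lookup_single when_def)

lemma pair_in_B: "i \<noteq> j \<Longrightarrow> unit_exp i + unit_exp j \<in> B \<longleftrightarrow> j \<in> neighbours \<Delta> i"
  using n_bounds face_in_V[of "{i, j}"]
  by (auto simp: B_iff lookup_add lookup_single when_def neighbours_def keys_add_nat insert_commute)

lemma square_in_B: "i \<in> V \<Longrightarrow> unit_exp i + unit_exp i \<in> B \<longleftrightarrow> n i \<ge> 3"
  using n_bounds vertex_face
  by (auto simp: B_iff lookup_add lookup_single when_def keys_add_nat numeral_3_eq_3 Suc_le_eq)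

lemma finite_face: "F \<in> \<Delta> \<Longrightarrow> finite F"
  using face_in_V finite_V finite_subset by metis

lemma keys_top_exp: "F \<subseteq> V \<Longrightarrow> Poly_Mapping.keys (top_exp n F) = F"
  using n_ge_2 finite_subset[OF _ finite_V, of F]
  by (force simp: in_keys_iff lookup_top_exp split: if_splits)

lemma top_exp_in_B: "F \<in> \<Delta> \<Longrightarrow> top_exp n F \<in> B"
  using face_in_V[of F] n_ge_2 finite_face[of F] by (force simp: B_iff keys_top_exp lookup_top_exp)

text \<open>Here \<open>dual a\<close> is \<open>x\<^sub>j\<close> times another dual vector, so its
  image is \<open>x\<^sub>j\<close> times an element without constant term and has no linear
  part.\<close>

lemma hom_dual_extendable:
  assumes \<phi>: "\<phi> \<in> H" and nonunit: "\<And>l. l \<in> carrier W \<Longrightarrow> cf 0 (\<phi> l) = 0"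
    and a: "a + unit_exp j \<in> B" and i: "i \<in> V"
  shows "cf (unit_exp i) (\<phi> (dual a)) = 0"
proof -
  have jB: "unit_exp j \<in> B" using a B_downward' by metis
  let ?y = "\<phi> (dual (unit_exp j + a))"
  have y: "?y \<in> carrier A" using hom_closed[OF \<phi>] by simp
  have "mon (unit_exp j) \<odot>\<^bsub>W\<^esub> dual (unit_exp j + a) = dual a"
    using a by (intro mon_smult_dual) (simp add: add.commute)
  then have eq: "\<phi> (dual a) = mon (unit_exp j) \<otimes>\<^bsub>A\<^esub> ?y"
    using hom_smult[OF \<phi> mon_closed dual_closed] by metis
  show ?thesis
  proof (cases "i = j")
    case True
    then show ?thesis
      using cf_mon_mult[OF y, of "unit_exp j" 0] jB nonunit[OF dual_closed] eq by simp
  next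
    case False
    then show ?thesis
      unfolding eq using unit_exp_in_B i jB y unit_exp_add_neq[of j i]
      by (intro cf_mon_mult_eq_0) auto
  qed
qed

text \<open>Since \<open>x\<^sub>j\<close> kills \<open>dual a\<close>, it kills the image; a term
  in \<open>x\<^sub>i\<close> would survive because the product of \<open>x\<^sub>i\<close> and
  \<open>x\<^sub>j\<close> is nonzero. The case \<open>i = j\<close> is included.\<close>

lemma hom_dual_annihilated:
  assumes \<phi>: "\<phi> \<in> H" and a: "Poly_Mapping.lookup a j = 0"
    and ij: "unit_exp i + unit_exp j \<in> B"
  shows "cf (unit_exp i) (\<phi> (dual a)) = 0"
proof -
  have "unit_exp j + b \<noteq> a" for b
    using a by (auto simp: lookup_add)
  then have "mon (unit_exp j) \<odot>\<^bsub>W\<^esub> dual a = lam (\<lambda>_. 0)"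
    by (rule mon_smult_dual_eq_0)
  then have "mon (unit_exp j) \<otimes>\<^bsub>A\<^esub> \<phi> (dual a) = \<zero>\<^bsub>A\<^esub>"
    using hom_smult[OF \<phi> mon_closed dual_closed] hom_lam_zero[OF \<phi>] by metis
  moreover have "unit_exp j + unit_exp i \<in> B" using ij by (simp add: add.commute)
  ultimately show ?thesis
    using cf_mon_mult[OF hom_closed[OF \<phi> dual_closed]] cf_zero by metis
qed

text \<open>If the support could be enlarged by \<open>j\<close>, then exponent one at
  \<open>j\<close> would still be standard, as \<open>n j\<close> is at least two.\<close>

lemma maximal_exponent_facet:
  assumes a: "a \<in> B" and max: "\<And>j. j \<in> V \<Longrightarrow> a + unit_exp j \<notin> B"
  shows "facet (Poly_Mapping.keys a)"
  unfolding facet_def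
proof (intro conjI ballI notI)
  show "Poly_Mapping.keys a \<in> \<Delta>" using a by (simp add: B_iff)
next
  fix j assume j: "j \<in> V - Poly_Mapping.keys a" "insert j (Poly_Mapping.keys a) \<in> \<Delta>"
  have "a + unit_exp j \<in> B"
    using a j n_ge_2[of j]
    by (auto simp: B_iff keys_add_nat lookup_add lookup_single when_def in_keys_iff)
  then show False using max j by auto
qed

text \<open>Some \<open>dual a\<close> must contribute to the coefficient. Then \<open>a\<close>
  cannot be extended, so its support is the required facet; \<open>hom_dual_annihilated\<close> with
  \<open>j = i\<close> gives \<open>n i = 2\<close>, and with the other neighbours that they lie in
  the support.\<close>

lemma trace_condition_if_hom:
  assumes \<phi>: "\<phi> \<in> H" and nonunit: "\<And>l. l \<in> carrier W \<Longrightarrow> cf 0 (\<phi> l) = 0"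
    and i: "i \<in> V" and l: "l \<in> carrier W" and nz: "cf (unit_exp i) (\<phi> l) \<noteq> 0"
  shows "trace_condition n i"
proof -
  have iB: "unit_exp i \<in> B" using i unit_exp_in_B by simp
  have "\<exists>a\<in>B. cf (unit_exp i) (\<phi> (dual a)) \<noteq> 0"
  proof (rule ccontr)
    assume "\<not> ?thesis"
    then have "cf (unit_exp i) (\<phi> l) = 0"
      unfolding cf_hom[OF \<phi> l iB] by (intro sum.neutral) auto
    then show False using nz by simp
  qed
  then obtain a where a: "a \<in> B" "cf (unit_exp i) (\<phi> (dual a)) \<noteq> 0" by blast
  let ?F = "Poly_Mapping.keys a"
  have "facet ?F"
    using a hom_dual_extendable[OF \<phi> nonunit _ i] by (intro maximal_exponent_facet) blast+
  moreover have "n i = 2" if "i \<notin> ?F"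
    using hom_dual_annihilated[OF \<phi>, of a i i] that a(2) square_in_B[OF i] n_ge_2[OF i]
    by (auto simp: in_keys_iff)
  moreover have "j \<in> ?F" if "j \<in> neighbours \<Delta> i" "j \<noteq> i" for j
    using hom_dual_annihilated[OF \<phi>, of a j i] that a(2) pair_in_B[of i j]
    by (auto simp: in_keys_iff)
  ultimately show ?thesis unfolding trace_condition_def by blast
qed

end

text \<open>The failure of the Gorenstein property is recorded as \<open>nonunit\<close>, in the
  form supplied by \<open>gorenstein_if_hom_hits_unit\<close>.\<close>

locale nearly_gorenstein_SR = artinian_SR A V \<Delta> n cf
  for A :: "('k::field, 'a) module" and V \<Delta> n cf +
  assumes nonunit: "\<And>\<phi> l. \<phi> \<in> H \<Longrightarrow> l \<in> carrier W \<Longrightarrow> cf 0 (\<phi> l) = 0"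
    and maxideal_trace: "maxideal \<subseteq> canonical_trace ring_of_type_algebra A"
begin

lemma trace_eq: "canonical_trace ring_of_type_algebra A = maxideal"
  using canonical_trace_eq_maxideal nonunit maxideal_trace by blast

lemma mon_unit_exp_in_maxideal: "i \<in> V \<Longrightarrow> mon (unit_exp i) \<in> maxideal"
  using zero_in_B unit_exp_neq_0[of i] by (simp add: maxideal_def cf_mon)

lemma trace_conditions: "\<forall>i\<in>V. trace_condition n i"
proof
  fix i assume i: "i \<in> V"
  have iB: "unit_exp i \<in> B" using i unit_exp_in_B by simp
  have "mon (unit_exp i) \<in> family_sum A (\<lambda>\<phi>. \<phi> ` carrier W) H"
    using mon_unit_exp_in_maxideal[OF i] maxideal_trace unfolding canonical_trace_def by blast
  then obtain J l where J: "J \<subseteq> H" "\<And>j. l j \<in> carrier W"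
    "\<And>b. b \<in> B \<Longrightarrow> cf b (mon (unit_exp i)) = (\<Sum>j\<in>J. cf b (j (l j)))"
    by (rule cf_family_sum_homs[rotated]) auto
  have "(\<Sum>j\<in>J. cf (unit_exp i) (j (l j))) \<noteq> 0"
    using J(3)[OF iB] cf_mon[OF iB] by simp
  then obtain \<phi> where "\<phi> \<in> J" "cf (unit_exp i) (\<phi> (l \<phi>)) \<noteq> 0"
    by (meson sum.neutral)
  then show "trace_condition n i"
    using trace_condition_if_hom[of \<phi> i "l \<phi>"] J(1,2) nonunit i by blast
qed

lemmas component_eq' = component_eq[OF trace_conditions]
lemmas nonsimplex_component' = nonsimplex_component[OF trace_conditions]
lemmas simplex_components_eq' = simplex_components_eq[OF trace_conditions]

text \<open>With no vertices the algebra is the field, and the homomorphism of degree zero hits a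
  unit. This excludes a zero maximal ideal, for which no homomorphism at all would suffice.\<close>

lemma V_nonempty: "V \<noteq> {}"
proof
  assume V: "V = {}"
  then have "a = 0" if "a \<in> B" for a
    using that face_in_V[of "Poly_Mapping.keys a"] keys_eq_empty[of a] by (simp add: B_iff)
  then have B: "B = {0}" using zero_in_B by auto
  have "admissible 0" unfolding admissible_def unfolding B by auto
  then have "complement_hom {0} \<in> H" by (intro complement_hom_in) simp
  then have "cf 0 (complement_hom {0} (dual 0)) = 0" by (rule nonunit) simp
  moreover have "cf 0 (complement_hom {0} (dual 0)) =
      (\<Sum>d\<in>{0}. \<Sum>a\<in>B. if a + 0 = d then (if a = 0 then 1 else 0) else 0)"
    unfolding dual_def by (rule cf_complement_hom[OF zero_in_B])
  moreover have "(\<Sum>d\<in>{0}. \<Sum>a\<in>B. if a + 0 = d then (if a = 0 then 1 else 0) else 0) = (1 :: 'k)"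
    unfolding B by simp
  ultimately show False by simp
qed

text \<open>As \<open>d\<close> is not in \<open>B\<close>, the summand \<open>a\<close> is nonzero
  and has a vertex \<open>p\<close> of the component in its support. Every vertex \<open>q\<close>
  in the support of \<open>c\<close> is adjacent to \<open>p\<close>, so it lies in the component,
  where \<open>d\<close> is large enough to force \<open>c\<close> below \<open>b\<close>.\<close>

lemma component_admissible:
  assumes i: "i \<in> V" and supp: "Poly_Mapping.keys d \<subseteq> neighbours \<Delta> i"
    and large: "\<And>j. j \<in> neighbours \<Delta> i \<Longrightarrow> n j - 1 \<le> Poly_Mapping.lookup d j"
    and d: "d \<notin> B"
  shows "admissible d"
  unfolding admissible_def
proof (intro ballI allI impI)
  fix a b c assume a: "a \<in> B" and b: "b \<in> B" and ab: "a + b = d" and ac: "a + c \<in> B"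
  have "a \<noteq> 0" using ab b d by auto
  then obtain p where p: "p \<in> Poly_Mapping.keys a" by (metis all_not_in_conv keys_eq_empty)
  then have pC: "p \<in> neighbours \<Delta> i" using supp by (auto simp: keys_add_nat simp flip: ab)
  have "Poly_Mapping.lookup c q \<le> Poly_Mapping.lookup b q" for q
  proof (cases "q \<in> Poly_Mapping.keys c")
    case True
    have "{p, q} \<in> \<Delta>"
      using ac p True face_subset[of "Poly_Mapping.keys (a + c)" "{p, q}"]
      by (auto simp: B_iff keys_add_nat)
    then have "q \<in> neighbours \<Delta> p" by (simp add: neighbours_def)
    then have q: "q \<in> neighbours \<Delta> i" using component_eq'[OF i pC] by simp
    then have "q \<in> V" using neighbours_in_V by auto
    then have "Poly_Mapping.lookup a q + Poly_Mapping.lookup c q < n q"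
      using ac by (auto simp: B_iff lookup_add)
    moreover have "n q - 1 \<le> Poly_Mapping.lookup a q + Poly_Mapping.lookup b q"
      using large[OF q] by (simp add: lookup_add flip: ab)
    ultimately show ?thesis by simp
  qed (simp add: in_keys_iff)
  then have "b = c + (b - c)"
    by (intro poly_mapping_eqI) (simp add: lookup_add lookup_minus)
  then show "\<exists>e. b = c + e" by blast
qed

text \<open>The degree of the homomorphism whose image contains \<open>x\<^sub>i\<close>. On a component that is the boundary of a
  simplex all \<open>n\<^sub>j\<close> are \<open>2\<close>, so there the top exponent is \<open>1\<^sub>C\<close>, shared by all vertices.\<close>

definition vertex_degree :: "nat \<Rightarrow> (nat \<Rightarrow>\<^sub>0 nat)" where
  "vertex_degree i = (if neighbours \<Delta> i \<in> \<Delta> then top_exp n (neighbours \<Delta> i) + unit_exp i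
     else top_exp n (neighbours \<Delta> i))"

text \<open>The number of the homomorphism responsible for \<open>i\<close>. Vertices of a simplex
  component are ranked from one, so they get different homomorphisms; a boundary component uses only
  the first.\<close>

definition vertex_index :: "nat \<Rightarrow> nat" where
  "vertex_index i = (if neighbours \<Delta> i \<in> \<Delta> then card {j \<in> neighbours \<Delta> i. j \<le> i} else 1)"

text \<open>Each component contributes at most one degree. The image as a set counts the degree
  shared by all vertices of a boundary component only once.\<close>

definition combined_hom :: "nat \<Rightarrow> ('a \<Rightarrow> 'k) \<Rightarrow> 'a" where
  "combined_hom k = complement_hom (vertex_degree ` {i \<in> V. vertex_index i = k})"

lemma keys_vertex_degree: "i \<in> V \<Longrightarrow> Poly_Mapping.keys (vertex_degree i) = neighbours \<Delta> i"
  using neighbours_self[of i] keys_top_exp[OF neighbours_in_V]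
  by (auto simp: vertex_degree_def keys_add_nat)

text \<open>The degree leaves \<open>B\<close> for two different reasons: for a simplex its entry at
  \<open>i\<close> is \<open>n i\<close>, for a boundary its support is not a face.\<close>

lemma vertex_degree_admissible:
  assumes i: "i \<in> V"
  shows "admissible (vertex_degree i)"
proof (rule component_admissible[OF i])
  show "Poly_Mapping.keys (vertex_degree i) \<subseteq> neighbours \<Delta> i"
    by (simp add: keys_vertex_degree[OF i])
  show "n j - 1 \<le> Poly_Mapping.lookup (vertex_degree i) j" if "j \<in> neighbours \<Delta> i" for j
    using that by (auto simp: vertex_degree_def lookup_add lookup_top_exp finite_neighbours)
  show "vertex_degree i \<notin> B"
  proof (cases "neighbours \<Delta> i \<in> \<Delta>")
    case True
    then have "Poly_Mapping.lookup (vertex_degree i) i = n i"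
      using neighbours_self[OF i] n_ge_2[OF i]
      by (simp add: vertex_degree_def lookup_add lookup_top_exp finite_neighbours)
    then show ?thesis using i by (metis B_iff less_irrefl)
  next
    case False
    then show ?thesis using keys_vertex_degree[OF i] by (auto simp: B_iff)
  qed
qed

lemma combined_hom_in: "combined_hom k \<in> H"
  unfolding combined_hom_def using vertex_degree_admissible by (intro complement_hom_in) auto

lemma vertex_index_inj:
  assumes i: "i \<in> V" and j: "j \<in> neighbours \<Delta> i" and C: "neighbours \<Delta> i \<in> \<Delta>"
    and eq: "vertex_index i = vertex_index j"
  shows "i = j"
proof -
  have N: "neighbours \<Delta> j = neighbours \<Delta> i" by (rule component_eq'[OF i j])
  have less: "card {k \<in> neighbours \<Delta> i. k \<le> p} < card {k \<in> neighbours \<Delta> i. k \<le> q}"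
    if pq: "p < q" "q \<in> neighbours \<Delta> i" for p q
  proof (rule psubset_card_mono)
    show "finite {k \<in> neighbours \<Delta> i. k \<le> q}" using finite_neighbours[of i] by simp
    have "q \<in> {k \<in> neighbours \<Delta> i. k \<le> q}" "q \<notin> {k \<in> neighbours \<Delta> i. k \<le> p}" using pq by auto
    moreover have "{k \<in> neighbours \<Delta> i. k \<le> p} \<subseteq> {k \<in> neighbours \<Delta> i. k \<le> q}" using pq by auto
    ultimately show "{k \<in> neighbours \<Delta> i. k \<le> p} \<subset> {k \<in> neighbours \<Delta> i. k \<le> q}" by blast
  qed
  have "card {k \<in> neighbours \<Delta> i. k \<le> i} = card {k \<in> neighbours \<Delta> i. k \<le> j}"
    using eq C N by (simp add: vertex_index_def)
  then show ?thesis
    using less[of i j] less[of j i] j neighbours_self[OF i] by (metis less_irrefl linorder_neqE_nat)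
qed

text \<open>The exponent \<open>a\<close> is the top exponent of the component, or in the boundary
  case of the component without \<open>i\<close>, where \<open>n i = 2\<close> makes the missing
  entry one. It is nonzero so that its support identifies the component.\<close>

lemma vertex_degree_split:
  assumes i: "i \<in> V"
  obtains a where "a \<in> B" "a \<noteq> 0" "a + unit_exp i = vertex_degree i"
proof (cases "neighbours \<Delta> i \<in> \<Delta>")
  case True
  have "Poly_Mapping.keys (top_exp n (neighbours \<Delta> i)) = neighbours \<Delta> i"
    by (rule keys_top_exp[OF neighbours_in_V])
  then have "top_exp n (neighbours \<Delta> i) \<noteq> 0" using neighbours_self[OF i] by auto
  then show ?thesis
    using that[of "top_exp n (neighbours \<Delta> i)"] top_exp_in_B[OF True] True by (simp add: vertex_degree_def)
next
  case False
  let ?C = "neighbours \<Delta> i"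
  have C: "?C - {i} \<in> \<Delta>" "n i = 2"
    using nonsimplex_component'[OF i False neighbours_self[OF i]] by auto
  have ne: "?C - {i} \<noteq> {}"
  proof
    assume "?C - {i} = {}"
    then have "?C = {i}" using neighbours_self[OF i] by auto
    then show False using False i vertex_face by simp
  qed
  have "?C - {i} \<subseteq> V" using neighbours_in_V by auto
  then have "top_exp n (?C - {i}) \<noteq> 0" using keys_top_exp[of "?C - {i}"] ne by (metis keys_zero)
  moreover have "top_exp n (?C - {i}) + unit_exp i = vertex_degree i"
    using False C(2) neighbours_self[OF i]
    by (intro poly_mapping_eqI)
      (auto simp: vertex_degree_def lookup_add lookup_top_exp finite_neighbours lookup_single when_def)
  ultimately show ?thesis using that top_exp_in_B[OF C(1)] by blast
qed

text \<open>The support of \<open>a\<close> pins down the component and the index then pins down the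
  degree, so all other degrees send \<open>dual a\<close> to zero and exactly
  \<open>x\<^sub>i\<close> is left.\<close>

lemma combined_hom_hits_variable:
  assumes i: "i \<in> V"
  shows "\<exists>l\<in>carrier W. combined_hom (vertex_index i) l = mon (unit_exp i)"
proof -
  let ?D = "vertex_degree ` {j \<in> V. vertex_index j = vertex_index i}"
  obtain a where a: "a \<in> B" "a \<noteq> 0" "a + unit_exp i = vertex_degree i"
    using vertex_degree_split[OF i] by blast
  have finD: "finite ?D" using finite_V by simp
  have iff: "a + b \<in> ?D \<longleftrightarrow> b = unit_exp i" for b
  proof
    assume "a + b \<in> ?D"
    then obtain j where j: "j \<in> V" "vertex_index j = vertex_index i" "a + b = vertex_degree j"
      by auto
    obtain p where p: "p \<in> Poly_Mapping.keys a" using a(2) by (metis all_not_in_conv keys_eq_empty)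
    have "p \<in> neighbours \<Delta> i" "p \<in> neighbours \<Delta> j"
      using p keys_vertex_degree[OF i] keys_vertex_degree[OF j(1)]
      by (auto simp: keys_add_nat simp flip: a(3) j(3))
    then have N: "neighbours \<Delta> i = neighbours \<Delta> j"
      using component_eq'[OF i] component_eq'[OF j(1)] by metis
    \<comment> \<open>In a simplex component equal indices force \<open>i = j\<close>; in a boundary
      component the vertices may differ, but their degrees agree.\<close>
    have "vertex_degree i = vertex_degree j"
    proof (cases "neighbours \<Delta> i \<in> \<Delta>")
      case True
      then have "i = j" using vertex_index_inj[OF i _ True] N neighbours_self[OF j(1)] j(2) by simp
      then show ?thesis by simp
    next
      case False
      then show ?thesis using N by (simp add: vertex_degree_def)
    qed
    then show "b = unit_exp i" using a(3) j(3) by (metis add_left_cancel)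
  next
    assume "b = unit_exp i"
    then show "a + b \<in> ?D" using a(3) i by auto
  qed
  have "combined_hom (vertex_index i) (dual a) = mon (unit_exp i)"
  proof (rule cf_eqI)
    fix b assume b: "b \<in> B"
    have "cf b (combined_hom (vertex_index i) (dual a)) =
        (\<Sum>d\<in>?D. \<Sum>a'\<in>B. if a' + b = d then (if a' = a then 1 else 0) else 0)"
      unfolding combined_hom_def dual_def by (rule cf_complement_hom[OF b])
    also have "\<dots> = (\<Sum>d\<in>?D. \<Sum>a'\<in>B. if a' = a then (if a + b = d then 1 else 0) else 0)"
      by (intro sum.cong refl) auto
    also have "\<dots> = (\<Sum>d\<in>?D. if a + b = d then 1 else 0)"
      using a(1) finite_B by simp
    also have "\<dots> = (if a + b \<in> ?D then 1 else 0)"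
      using finD by (simp only: sum.delta')
    finally show "cf b (combined_hom (vertex_index i) (dual a)) = cf b (mon (unit_exp i))"
      unfolding iff using b by (simp add: cf_mon)
  qed (use hom_closed[OF combined_hom_in] in auto)
  then show ?thesis by (metis dual_closed)
qed

definition max_size :: nat where
  "max_size = Max ({1} \<union> {card C | C. C \<in> simplex_components V \<Delta>})"

lemma finite_sizes: "finite ({1} \<union> {card C | C. C \<in> simplex_components V \<Delta>})"
  unfolding simplex_components_eq' using finite_V by auto

lemma vertex_index_range:
  assumes i: "i \<in> V"
  shows "vertex_index i \<in> {1..max_size}"
proof (cases "neighbours \<Delta> i \<in> \<Delta>")
  case True
  let ?S = "{j \<in> neighbours \<Delta> i. j \<le> i}"
  have fin: "finite ?S" using finite_neighbours[of i] by simp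
  have "i \<in> ?S" using neighbours_self[OF i] by simp
  then have "0 < card ?S" using fin card_gt_0_iff by blast
  moreover have "card ?S \<le> card (neighbours \<Delta> i)"
    by (intro card_mono finite_neighbours) auto
  moreover have "card (neighbours \<Delta> i) \<le> max_size"
    unfolding max_size_def using i True by (intro Max_ge finite_sizes) (auto simp: simplex_components_eq')
  ultimately show ?thesis using True by (simp add: vertex_index_def)
next
  case False
  have "1 \<le> max_size" unfolding max_size_def by (intro Max_ge finite_sizes) auto
  then show ?thesis using False by (simp add: vertex_index_def)
qed

lemma combined_homs_cover:
  "family_sum A (\<lambda>k. combined_hom k ` carrier W) {1..max_size} = maxideal"
proof (rule family_sum_homs_eq_maxideal)
  fix i assume "unit_exp i \<in> B"
  then have i: "i \<in> V" using unit_exp_in_B by simp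
  obtain l where l: "l \<in> carrier W" "combined_hom (vertex_index i) l = mon (unit_exp i)"
    using combined_hom_hits_variable[OF i] by blast
  show "mon (unit_exp i) \<in> family_sum A (\<lambda>k. combined_hom k ` carrier W) {1..max_size}"
    using family_sum_homs_incl[of "{1..max_size}" combined_hom "vertex_index i" l]
      combined_hom_in vertex_index_range[OF i] l by simp
qed (use combined_hom_in nonunit in auto)

text \<open>If \<open>a\<close> extends, there is no linear part. Otherwise, a support meeting the
  component would stay inside it and force \<open>a\<close> to be the top exponent. So
  \<open>a\<close> vanishes at \<open>j\<close>, and \<open>x\<^sub>j\<close> kills
  \<open>dual a\<close> but not \<open>x\<^sub>i\<close>.\<close>

lemma hom_dual_linear_part:
  assumes \<phi>: "\<phi> \<in> H" and C: "neighbours \<Delta> p \<in> \<Delta>" and p: "p \<in> V"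
    and i: "i \<in> neighbours \<Delta> p" and j: "j \<in> neighbours \<Delta> p" "j \<noteq> i"
    and a: "a \<in> B" "a \<noteq> top_exp n (neighbours \<Delta> p)"
  shows "cf (unit_exp i) (\<phi> (dual a)) = 0"
proof (cases "\<exists>q. a + unit_exp q \<in> B")
  case True
  then show ?thesis using hom_dual_extendable[OF \<phi> nonunit[OF \<phi>]] i neighbours_in_V by blast
next
  case False
  let ?C = "neighbours \<Delta> p"
  have "Poly_Mapping.keys a \<inter> ?C = {}"
  proof (rule ccontr)
    assume "Poly_Mapping.keys a \<inter> ?C \<noteq> {}"
    then obtain q where q: "q \<in> Poly_Mapping.keys a" "q \<in> ?C" by blast
    have "Poly_Mapping.keys a \<subseteq> ?C"
      using face_subset_neighbours[of "Poly_Mapping.keys a" q] a(1) q component_eq'[OF p q(2)]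
      by (auto simp: B_iff)
    have "Poly_Mapping.lookup a r = n r - 1" if r: "r \<in> ?C" for r
    proof -
      have "r \<in> V" using r neighbours_in_V by auto
      \<comment> \<open>Since \<open>?C\<close> is a face, raising the exponent at \<open>r\<close>
        can leave \<open>B\<close> only by reaching the bound \<open>n r\<close>.\<close>
      have "Poly_Mapping.keys (a + unit_exp r) \<in> \<Delta>"
        using \<open>Poly_Mapping.keys a \<subseteq> ?C\<close> r by (intro face_subset[OF C]) (auto simp: keys_add_nat)
      then obtain s where s: "s \<in> V" "n s \<le> Poly_Mapping.lookup (a + unit_exp r) s"
        using False by (auto simp: B_iff not_less)
      moreover have "Poly_Mapping.lookup a s < n s" using a(1) s by (simp add: B_iff)
      ultimately have "s = r" by (auto simp: lookup_add lookup_single when_def split: if_splits)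
      then show ?thesis using s \<open>Poly_Mapping.lookup a s < n s\<close> by (simp add: lookup_add)
    qed
    then have "a = top_exp n ?C"
      using \<open>Poly_Mapping.keys a \<subseteq> ?C\<close>
      by (intro poly_mapping_eqI) (auto simp: lookup_top_exp finite_neighbours in_keys_iff)
    then show False using a(2) by simp
  qed
  then have "Poly_Mapping.lookup a j = 0" using j by (auto simp: in_keys_iff)
  moreover have "unit_exp i + unit_exp j \<in> B"
    using pair_in_B[of i j] j component_eq'[OF p i] by auto
  ultimately show ?thesis by (rule hom_dual_annihilated[OF \<phi>])
qed

text \<open>On the linear forms supported on a simplex component \<open>C\<close> each homomorphism has rank at most
  one, since only the dual socle generator of \<open>C\<close> contributes.\<close>

lemma simplex_component_lower_bound:
  assumes \<psi>: "\<And>k. k \<in> {1..s} \<Longrightarrow> \<psi> k \<in> H"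
    and cover: "family_sum A (\<lambda>k. \<psi> k ` carrier W) {1..s} = maxideal"
    and C: "C \<in> simplex_components V \<Delta>" "card C \<ge> 2"
  shows "card C \<le> s"
proof -
  obtain p where p: "p \<in> V" "C = neighbours \<Delta> p" "C \<in> \<Delta>"
    using C(1) unfolding simplex_components_eq' by blast
  let ?t = "top_exp n C"
  have tB: "?t \<in> B" using p top_exp_in_B by simp
  have CV: "C \<subseteq> V" using p neighbours_in_V by simp
  have linear: "cf (unit_exp i) (\<psi> k l) = l (mon ?t) * cf (unit_exp i) (\<psi> k (dual ?t))"
    if i: "i \<in> C" and k: "k \<in> {1..s}" and l: "l \<in> carrier W" for i k l
  proof -
    have iB: "unit_exp i \<in> B" using i CV unit_exp_in_B by auto
    \<comment> \<open>Two vertices in \<open>C\<close> are needed to provide the \<open>j\<close> of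
      \<open>hom_dual_linear_part\<close>.\<close>
    have "C \<noteq> {i}" using C(2) by auto
    then obtain j where j: "j \<in> C" "j \<noteq> i" using i by blast
    have "cf (unit_exp i) (\<psi> k l) =
        (\<Sum>a\<in>B. if a = ?t then l (mon a) * cf (unit_exp i) (\<psi> k (dual a)) else 0)"
      unfolding cf_hom[OF \<psi>[OF k] l iB]
      using hom_dual_linear_part[OF \<psi>[OF k], of p i j] p i j by (intro sum.cong refl) auto
    then show ?thesis using tB finite_B by simp
  qed
  \<comment> \<open>The spanning vectors are the linear parts on \<open>C\<close> of the images
    \<open>\<psi> k (dual ?t)\<close>.\<close>
  have "card C \<le> card {1..s}"
  proof (rule unit_vectors_bound)
    show "finite C" using CV finite_V finite_subset by metis
    fix i assume i: "i \<in> C"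
    have "mon (unit_exp i) \<in> family_sum A (\<lambda>k. \<psi> k ` carrier W) {1..s}"
      unfolding cover using i CV mon_unit_exp_in_maxideal by auto
    then obtain J l where J: "finite J" "J \<subseteq> {1..s}" "\<And>j. l j \<in> carrier W"
      "\<And>b. b \<in> B \<Longrightarrow> cf b (mon (unit_exp i)) = (\<Sum>j\<in>J. cf b (\<psi> j (l j)))"
      by (rule cf_family_sum_homs[where I = "{1..s}" and \<psi> = \<psi>, rotated, OF _ _ \<psi>]) (assumption | blast)+
    \<comment> \<open>Coefficient zero outside \<open>J\<close> extends the sum to all of
      \<open>{1..s}\<close>.\<close>
    let ?c = "\<lambda>j. if j \<in> J then l j (mon ?t) else 0"
    have "(if i' = i then 1 else 0) = (\<Sum>j\<in>{1..s}. ?c j * cf (unit_exp i') (\<psi> j (dual ?t)))"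
      if i': "i' \<in> C" for i'
    proof -
      have i'B: "unit_exp i' \<in> B" using i' CV unit_exp_in_B by auto
      have "(if i' = i then 1 else 0) = cf (unit_exp i') (mon (unit_exp i))"
        using cf_mon[OF i'B] by (simp only: single_inj)
      also have "\<dots> = (\<Sum>j\<in>J. cf (unit_exp i') (\<psi> j (l j)))" by (rule J(4)[OF i'B])
      also have "\<dots> = (\<Sum>j\<in>J. l j (mon ?t) * cf (unit_exp i') (\<psi> j (dual ?t)))"
        using J(2,3) by (intro sum.cong refl linear[OF i']) auto
      also have "\<dots> = (\<Sum>j\<in>{1..s}. ?c j * cf (unit_exp i') (\<psi> j (dual ?t)))"
        using J(1,2) by (intro sum.mono_neutral_cong_left) auto
      finally show ?thesis .
    qed
    then show "\<exists>c. \<forall>i'\<in>C. (if i' = i then 1 else 0) =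
        (\<Sum>j\<in>{1..s}. c j * cf (unit_exp i') (\<psi> j (dual ?t)))"
      by (intro exI[of _ ?c] ballI)
  qed simp
  then show ?thesis by simp
qed

lemma family_sum_empty: "family_sum A U {} = {\<zero>\<^bsub>A\<^esub>}"
  by (auto simp: family_sum_def)

theorem teter_number_eq: "teter_number ring_of_type_algebra A = max_size"
  unfolding teter_number_def trace_eq
proof (rule Least_equality)
  show "\<exists>\<psi>. (\<forall>i\<in>{1..max_size}. \<psi> i \<in> H) \<and>
      maxideal = family_sum A (\<lambda>i. \<psi> i ` carrier W) {1..max_size}"
    using combined_homs_cover combined_hom_in by blast
next
  fix s :: nat assume "\<exists>\<psi>. (\<forall>i\<in>{1..s}. \<psi> i \<in> H) \<and>
      maxideal = family_sum A (\<lambda>i. \<psi> i ` carrier W) {1..s}"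
  then obtain \<psi> where \<psi>: "\<And>i. i \<in> {1..s} \<Longrightarrow> \<psi> i \<in> H"
    "family_sum A (\<lambda>i. \<psi> i ` carrier W) {1..s} = maxideal" by blast
  \<comment> \<open>The empty sum is zero, while the maximal ideal contains the nonzero
    \<open>x\<^sub>i\<close>.\<close>
  have "s \<noteq> 0"
  proof
    assume "s = 0"
    then have "maxideal = {\<zero>\<^bsub>A\<^esub>}" using \<psi>(2) by (simp add: family_sum_empty)
    moreover obtain i where i: "i \<in> V" using V_nonempty by blast
    ultimately have "mon (unit_exp i) = \<zero>\<^bsub>A\<^esub>" using mon_unit_exp_in_maxideal by blast
    then show False using cf_mon[of "unit_exp i" "unit_exp i"] cf_zero[of "unit_exp i"] i unit_exp_in_B by simp
  qed
  \<comment> \<open>Components with one vertex are covered by \<open>s \<noteq> 0\<close>, since the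
    lower bound lemma assumes at least two.\<close>
  moreover have "card C \<le> s" if "C \<in> simplex_components V \<Delta>" for C
    using simplex_component_lower_bound[OF \<psi> that] \<open>s \<noteq> 0\<close> by linarith
  ultimately show "max_size \<le> s"
    unfolding max_size_def using finite_sizes by (subst Max_le_iff) auto
qed

lemma max_size_eq_1_iff: "max_size = 1 \<longleftrightarrow> (\<forall>C\<in>simplex_components V \<Delta>. is_singleton C)"
proof -
  have "card C \<ge> 1" if "C \<in> simplex_components V \<Delta>" for C
    using that neighbours_self finite_neighbours unfolding simplex_components_eq'
    by (auto simp: Suc_le_eq card_gt_0_iff)
  moreover have "max_size = 1 \<longleftrightarrow> (\<forall>C\<in>simplex_components V \<Delta>. card C \<le> 1)"
  proof
    assume "max_size = 1"
    then show "\<forall>C\<in>simplex_components V \<Delta>. card C \<le> 1"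
      unfolding max_size_def using Max_ge[OF finite_sizes] by fastforce
  next
    assume "\<forall>C\<in>simplex_components V \<Delta>. card C \<le> 1"
    then show "max_size = 1"
      unfolding max_size_def by (intro Max_eqI finite_sizes) auto
  qed
  ultimately show ?thesis
    unfolding is_singleton_altdef by (auto intro: le_antisym)
qed

end

section \<open>The monomial basis of the Artinian reduction\<close>

lemma sum_monomials: "(\<Sum>u\<in>Poly_Mapping.keys p. Poly_Mapping.single u (Poly_Mapping.lookup p u)) = p"
  by (rule poly_mapping_eqI) (simp add: lookup_sum lookup_single when_def in_keys_iff)

lemma lookup_mult_eq_sum:
  fixes p q :: "'b::comm_monoid_add \<Rightarrow>\<^sub>0 'k::comm_semiring_1"
  shows "Poly_Mapping.lookup (p * q) a = (\<Sum>u\<in>Poly_Mapping.keys p. \<Sum>v\<in>Poly_Mapping.keys q.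
    if u + v = a then Poly_Mapping.lookup p u * Poly_Mapping.lookup q v else 0)"
proof -
  have "p * q = (\<Sum>u\<in>Poly_Mapping.keys p. Poly_Mapping.single u (Poly_Mapping.lookup p u)) *
      (\<Sum>v\<in>Poly_Mapping.keys q. Poly_Mapping.single v (Poly_Mapping.lookup q v))"
    by (simp only: sum_monomials)
  also have "\<dots> = (\<Sum>u\<in>Poly_Mapping.keys p. \<Sum>v\<in>Poly_Mapping.keys q.
      Poly_Mapping.single (u + v) (Poly_Mapping.lookup p u * Poly_Mapping.lookup q v))"
    by (simp only: sum_product mult_single)
  finally show ?thesis by (simp only: lookup_sum lookup_single when_def)
qed

text \<open>The supports of \<open>p\<close> and \<open>q\<close> are unrelated to \<open>B\<close>.
  The sums are enlarged to unions and then cut down to \<open>B\<close>, because both summands of an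
  exponent in \<open>B\<close> lie in \<open>B\<close>.\<close>

lemma lookup_mult_downward:
  fixes p q :: "'b::comm_monoid_add \<Rightarrow>\<^sub>0 'k::comm_semiring_1"
  assumes B: "finite B" "\<And>a b. a + b \<in> B \<Longrightarrow> a \<in> B" and a: "a \<in> B"
  shows "Poly_Mapping.lookup (p * q) a = (\<Sum>u\<in>B. \<Sum>v\<in>B.
    if u + v = a then Poly_Mapping.lookup p u * Poly_Mapping.lookup q v else 0)"
proof -
  let ?f = "\<lambda>u v. if u + v = a then Poly_Mapping.lookup p u * Poly_Mapping.lookup q v else 0"
  let ?S = "Poly_Mapping.keys p \<union> B" and ?T = "Poly_Mapping.keys q \<union> B"
  have inB: "u \<in> B" "v \<in> B" if "u + v = a" for u v
    using that a B(2)[of u v] B(2)[of v u] by (auto simp: add.commute)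
  have "Poly_Mapping.lookup (p * q) a = (\<Sum>u\<in>Poly_Mapping.keys p. \<Sum>v\<in>Poly_Mapping.keys q. ?f u v)"
    by (rule lookup_mult_eq_sum)
  also have "\<dots> = (\<Sum>u\<in>?S. \<Sum>v\<in>?T. ?f u v)"
  proof (rule sum.mono_neutral_cong_left)
    show "\<And>u. (\<Sum>v\<in>Poly_Mapping.keys q. ?f u v) = (\<Sum>v\<in>?T. ?f u v)"
      using B(1) by (intro sum.mono_neutral_left) (auto simp: in_keys_iff)
  qed (use B(1) in \<open>auto simp: in_keys_iff intro!: sum.neutral\<close>)
  also have "\<dots> = (\<Sum>u\<in>B. \<Sum>v\<in>B. ?f u v)"
  proof (rule sum.mono_neutral_cong_right)
    show "\<And>u. (\<Sum>v\<in>?T. ?f u v) = (\<Sum>v\<in>B. ?f u v)"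
      using B(1) inB by (intro sum.mono_neutral_right) auto
  qed (use B(1) inB in \<open>auto intro!: sum.neutral\<close>)
  finally show ?thesis .
qed

lemma prod_var_eq: "finite F \<Longrightarrow> (\<Prod>i\<in>F. var i) = Poly_Mapping.single (\<Sum>i\<in>F. unit_exp i) 1"
  by (induction F rule: finite_induct) (simp_all add: var_def mult_single)

lemma var_power_eq: "var i ^ k = Poly_Mapping.single (Poly_Mapping.single i k) 1"
  by (induction k) (simp_all add: var_def mult_single flip: single_add)

lemma finite_bounded_exponents:
  assumes "finite V"
  shows "finite {a :: nat \<Rightarrow>\<^sub>0 nat. Poly_Mapping.keys a \<subseteq> V \<and> (\<forall>i\<in>V. Poly_Mapping.lookup a i \<le> n i)}"
    (is "finite ?S")
proof (rule finite_imageD)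
  have "(\<lambda>a. restrict (Poly_Mapping.lookup a) V) ` ?S \<subseteq> (\<Pi>\<^sub>E i\<in>V. {..n i})" by auto
  then show "finite ((\<lambda>a. restrict (Poly_Mapping.lookup a) V) ` ?S)"
    by (rule finite_subset) (intro finite_PiE assms finite_atMost)
  show "inj_on (\<lambda>a. restrict (Poly_Mapping.lookup a) V) ?S"
  proof (rule inj_onI, rule poly_mapping_eqI)
    fix a b k assume a: "a \<in> ?S" and b: "b \<in> ?S"
      and eq: "restrict (Poly_Mapping.lookup a) V = restrict (Poly_Mapping.lookup b) V"
    show "Poly_Mapping.lookup a k = Poly_Mapping.lookup b k"
    proof (cases "k \<in> V")
      case True
      then show ?thesis using fun_cong[OF eq, of k] by simp
    next
      case False
      then have "k \<notin> Poly_Mapping.keys a" "k \<notin> Poly_Mapping.keys b" using a b by auto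
      then show ?thesis by (simp add: in_keys_iff)
    qed
  qed
qed

lemma finite_standard_exponents:
  assumes "finite V" "\<Delta> \<subseteq> Pow V"
  shows "finite (standard_exponents \<Delta> n)"
proof (rule finite_subset)
  show "standard_exponents \<Delta> n \<subseteq>
      {a. Poly_Mapping.keys a \<subseteq> V \<and> (\<forall>i\<in>V. Poly_Mapping.lookup a i \<le> n i)}"
  proof
    fix a assume a: "a \<in> standard_exponents \<Delta> n"
    then have "Poly_Mapping.lookup a i \<le> n i" for i
      by (cases "i \<in> Poly_Mapping.keys a") (auto simp: standard_exponents_def in_keys_iff less_imp_le)
    then show "a \<in> {a. Poly_Mapping.keys a \<subseteq> V \<and> (\<forall>i\<in>V. Poly_Mapping.lookup a i \<le> n i)}"
      using a assms(2) by (auto simp: standard_exponents_def)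
  qed
qed (rule finite_bounded_exponents[OF assms(1)])

lemma standard_exponents_downward:
  assumes "simplicial_complex V \<Delta>" "a + b \<in> standard_exponents \<Delta> n"
  shows "a \<in> standard_exponents \<Delta> n"
proof -
  have "Poly_Mapping.keys a \<union> Poly_Mapping.keys b \<in> \<Delta>"
    and less: "\<forall>i\<in>Poly_Mapping.keys a \<union> Poly_Mapping.keys b.
      Poly_Mapping.lookup a i + Poly_Mapping.lookup b i < n i"
    using assms(2) by (auto simp: standard_exponents_def keys_add_nat lookup_add)
  then have "Poly_Mapping.keys a \<in> \<Delta>"
    using assms(1) unfolding simplicial_complex_def by (metis Un_upper1)
  then show ?thesis using less by (auto simp: standard_exponents_def intro: add_lessD1)
qed

(* Otherwise {1..m} is rewritten to {Suc 0..m} in goals but not in rewrite rules. *)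
declare One_nat_def [simp del]

locale SR_presentation =
  fixes m :: nat and \<Delta> :: "nat set set" and n :: "nat \<Rightarrow> nat"
  assumes complex: "simplicial_complex {1..m} \<Delta>" and n_pos: "\<And>i. i \<in> {1..m} \<Longrightarrow> n i > 0"
begin

section \<open>The defining ideal as the span of the nonstandard monomials\<close>

abbreviation R :: "('k::field, 'k mpoly) module" where "R \<equiv> poly_algebra {1..m}"

abbreviation I :: "'k::field mpoly set" where "I \<equiv> artinian_ideal m \<Delta> n"

abbreviation E :: "(nat \<Rightarrow>\<^sub>0 nat) set" where "E \<equiv> standard_exponents \<Delta> n"

lemmas E_downward = standard_exponents_downward[OF complex]

lemma finite_E: "finite E"
  using complex by (intro finite_standard_exponents[of "{1..m}"]) (auto simp: simplicial_complex_def)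

lemma E_keys: "a \<in> E \<Longrightarrow> Poly_Mapping.keys a \<subseteq> {1..m}"
  using complex by (auto simp: standard_exponents_def simplicial_complex_def)

lemma zero_in_E: "0 \<in> E"
  using complex by (simp add: standard_exponents_def simplicial_complex_def)

lemma R_simps:
  "p \<otimes>\<^bsub>R\<^esub> q = p * q" "p \<oplus>\<^bsub>R\<^esub> q = p + q" "\<zero>\<^bsub>R\<^esub> = 0" "\<one>\<^bsub>R\<^esub> = 1"
  "c \<odot>\<^bsub>R\<^esub> p = Poly_Mapping.single 0 c * p"
  by (simp_all add: poly_algebra_def)

lemma R_carrier: "p \<in> carrier R \<longleftrightarrow> (\<forall>t\<in>Poly_Mapping.keys p. Poly_Mapping.keys t \<subseteq> {1..m})"
  by (simp add: poly_algebra_def)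

lemma single_in_R: "Poly_Mapping.keys a \<subseteq> {1..m} \<Longrightarrow> Poly_Mapping.single a c \<in> carrier R"
  by (simp add: R_carrier)

interpretation R: cring "R :: ('k::field, 'k mpoly) module"
  by (rule cring_poly_algebra)

interpretation I: ideal "I :: 'k::field mpoly set" "R"
  by (rule ideal_artinian_ideal)

text \<open>The explicit form of \<open>I\<close>; equality is
  \<open>I_eq_vanishing\<close>.\<close>

definition vanishing :: "'k::field mpoly set" where
  "vanishing = {p \<in> carrier R. \<forall>a\<in>E. Poly_Mapping.lookup p a = 0}"

text \<open>A standard monomial in a product would have a divisor in the support of
  \<open>p\<close>, which is standard because \<open>E\<close> is closed under divisors.\<close>

lemma vanishing_ideal: "ideal (vanishing :: 'k::field mpoly set) R"
proof (rule idealI)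
  show "ring (R :: ('k, 'k mpoly) module)" by (rule R.ring_axioms)
  show "subgroup (vanishing :: 'k mpoly set) (add_monoid R)"
  proof (rule R.add.subgroupI)
    show "(vanishing :: 'k mpoly set) \<noteq> {}"
      using R.zero_closed by (auto simp: vanishing_def R_simps)
    fix p :: "'k mpoly" assume p: "p \<in> vanishing"
    then have "- p \<in> carrier R" "\<ominus>\<^bsub>R\<^esub> p = - p"
      using R.minus_equality[of "- p" p] by (auto simp: R_simps R_carrier vanishing_def)
    then show "\<ominus>\<^bsub>R\<^esub> p \<in> vanishing"
      using p by (auto simp: vanishing_def)
  next
    fix p q :: "'k mpoly" assume "p \<in> vanishing" "q \<in> vanishing"
    then show "p \<oplus>\<^bsub>R\<^esub> q \<in> vanishing"
      using R.a_closed[of p q] by (auto simp: vanishing_def lookup_add R_simps)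
  qed (auto simp: vanishing_def)
  fix p x :: "'k mpoly" assume p: "p \<in> vanishing" and x: "x \<in> carrier R"
  have "Poly_Mapping.lookup (x * p) a = 0" if a: "a \<in> E" for a
  proof (rule ccontr)
    assume "\<not> ?thesis"
    then have "a \<in> Poly_Mapping.keys (x * p)" by (simp add: in_keys_iff)
    then obtain u v where uv: "v \<in> Poly_Mapping.keys p" "a = u + v" using keys_times_subset by blast
    then have "v \<in> E" using a E_downward[of v u] by (simp add: add.commute)
    then show False using uv p by (auto simp: vanishing_def in_keys_iff)
  qed
  then show "x \<otimes>\<^bsub>R\<^esub> p \<in> vanishing"
    using x p R.m_closed[of x p] by (auto simp: vanishing_def R_simps)
  then show "p \<otimes>\<^bsub>R\<^esub> x \<in> vanishing" by (simp add: R_simps mult.commute)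
qed

lemma keys_sum_units: "finite F \<Longrightarrow> Poly_Mapping.keys (\<Sum>i\<in>F. unit_exp i) = F"
  by (auto simp: in_keys_iff lookup_sum lookup_single when_def split: if_splits)

lemma nonface_monomial_nonstandard:
  assumes "F \<subseteq> {1..m}" "F \<notin> \<Delta>"
  shows "(\<Sum>i\<in>F. unit_exp i) \<notin> E"
proof -
  have "finite F" using assms finite_subset by blast
  then have "Poly_Mapping.keys (\<Sum>i\<in>F. unit_exp i) = F" by (rule keys_sum_units)
  then show ?thesis using assms(2) unfolding standard_exponents_def by simp
qed

lemma power_nonstandard: "i \<in> {1..m} \<Longrightarrow> Poly_Mapping.single i (n i) \<notin> E"
  using n_pos[of i] by (auto simp: standard_exponents_def)

lemma single_vanishing:
  assumes "Poly_Mapping.keys a \<subseteq> {1..m}" "a \<notin> E"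
  shows "Poly_Mapping.single a c \<in> vanishing"
  using assms single_in_R by (auto simp: vanishing_def lookup_single when_def)

lemma generators_closed:
  "{\<Prod>i\<in>F. var i | F. F \<subseteq> {1..m} \<and> F \<notin> \<Delta>} \<subseteq> (vanishing :: 'k::field mpoly set)"
  "{var i ^ n i | i. i \<in> {1..m}} \<subseteq> (vanishing :: 'k::field mpoly set)"
proof safe
  fix F assume F: "F \<subseteq> {1..m}" "F \<notin> \<Delta>"
  then have fin: "finite F" using finite_subset by blast
  show "(\<Prod>i\<in>F. var i) \<in> (vanishing :: 'k mpoly set)"
    unfolding prod_var_eq[OF fin]
    using F nonface_monomial_nonstandard[OF F] keys_sum_units[OF fin] by (intro single_vanishing) auto
next
  fix i assume i: "i \<in> {1..m}"
  show "var i ^ n i \<in> (vanishing :: 'k mpoly set)"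
    unfolding var_power_eq using i power_nonstandard[OF i] by (intro single_vanishing) auto
qed

text \<open>The monomial is divisible by a generator: by the squarefree monomial of its support if
  that is a nonface, and otherwise by some power of a variable.\<close>

lemma nonstandard_single_in_I:
  assumes a: "Poly_Mapping.keys a \<subseteq> {1..m}" "a \<notin> E"
  shows "Poly_Mapping.single a c \<in> (I :: 'k::field mpoly set)"
proof -
  let ?SR = "stanley_reisner_ideal m \<Delta> :: 'k mpoly set" and ?VP = "var_powers_ideal m n :: 'k mpoly set"
  have gen: "{\<Prod>i\<in>F. var i | F. F \<subseteq> {1..m} \<and> F \<notin> \<Delta>} \<subseteq> carrier (R :: ('k, 'k mpoly) module)"
    "{var i ^ n i | i. i \<in> {1..m}} \<subseteq> carrier (R :: ('k, 'k mpoly) module)"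
    using generators_closed[where ?'k = 'k] by (auto simp: vanishing_def)
  interpret SR: ideal ?SR R unfolding stanley_reisner_ideal_def by (rule R.genideal_ideal[OF gen(1)])
  interpret VP: ideal ?VP R unfolding var_powers_ideal_def by (rule R.genideal_ideal[OF gen(2)])
  have SR_I: "p \<in> I" if "p \<in> ?SR" for p
  proof -
    have "p \<oplus>\<^bsub>R\<^esub> \<zero>\<^bsub>R\<^esub> \<in> I"
      unfolding artinian_ideal_def set_add_def' using that VP.zero_closed by blast
    then show ?thesis by (simp add: R_simps)
  qed
  have VP_I: "p \<in> I" if "p \<in> ?VP" for p
  proof -
    have "\<zero>\<^bsub>R\<^esub> \<oplus>\<^bsub>R\<^esub> p \<in> I"
      unfolding artinian_ideal_def set_add_def' using that SR.zero_closed by blast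
    then show ?thesis by (simp add: R_simps)
  qed
  \<comment> \<open>Subtraction is truncated, so \<open>a = (a - b) + b\<close> expresses that
    \<open>x\<^sup>b\<close> divides \<open>x\<^sup>a\<close>.\<close>
  have mult: "Poly_Mapping.single a c \<in> I"
    if "Poly_Mapping.single b (1 :: 'k) \<in> I" "a = (a - b) + b" for b
  proof -
    have "Poly_Mapping.keys (a - b) \<subseteq> Poly_Mapping.keys a"
      by (auto simp: in_keys_iff lookup_minus)
    then have "Poly_Mapping.keys (a - b) \<subseteq> {1..m}" using a(1) by blast
    then have "Poly_Mapping.single (a - b) c \<otimes>\<^bsub>R\<^esub> Poly_Mapping.single b 1 \<in> I"
      using that(1) by (intro I.I_l_closed single_in_R)
    then show ?thesis using that(2) by (simp add: R_simps mult_single)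
  qed
  show ?thesis
  proof (cases "Poly_Mapping.keys a \<in> \<Delta>")
    case False
    let ?F = "Poly_Mapping.keys a"
    have "(\<Prod>i\<in>?F. var i) \<in> {\<Prod>i\<in>F. var i :: 'k mpoly | F. F \<subseteq> {1..m} \<and> F \<notin> \<Delta>}"
      using a(1) False by blast
    then have "(\<Prod>i\<in>?F. var i) \<in> ?SR"
      unfolding stanley_reisner_ideal_def using R.genideal_self[OF gen(1)] by blast
    then have "Poly_Mapping.single (\<Sum>i\<in>?F. unit_exp i) (1 :: 'k) \<in> I"
      using SR_I[of "\<Prod>i\<in>?F. var i"] by (simp only: prod_var_eq[OF finite_keys])
    moreover have "a = (a - (\<Sum>i\<in>?F. unit_exp i)) + (\<Sum>i\<in>?F. unit_exp i)"
      by (rule poly_mapping_eqI)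
        (simp add: lookup_add lookup_minus lookup_sum lookup_single when_def in_keys_iff)
    ultimately show ?thesis by (rule mult)
  next
    case True
    then obtain i where i: "i \<in> Poly_Mapping.keys a" "n i \<le> Poly_Mapping.lookup a i"
      using a(2) by (auto simp: standard_exponents_def not_less)
    have "var i ^ n i \<in> {var i ^ n i :: 'k mpoly | i. i \<in> {1..m}}" using i a(1) by blast
    then have "var i ^ n i \<in> ?VP"
      unfolding var_powers_ideal_def using R.genideal_self[OF gen(2)] by blast
    then have "Poly_Mapping.single (Poly_Mapping.single i (n i)) (1 :: 'k) \<in> I"
      using VP_I[of "var i ^ n i"] by (simp only: var_power_eq)
    moreover have "a = (a - Poly_Mapping.single i (n i)) + Poly_Mapping.single i (n i)"
      using i(2) by (intro poly_mapping_eqI) (auto simp: lookup_add lookup_minus lookup_single when_def)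
    ultimately show ?thesis by (rule mult)
  qed
qed

text \<open>The generators vanish on \<open>E\<close>; conversely a polynomial vanishing on
  \<open>E\<close> is a sum of nonstandard terms, each in the ideal.\<close>

lemma I_eq_vanishing: "(I :: 'k::field mpoly set) = vanishing"
proof
  interpret N: ideal "vanishing :: 'k mpoly set" R by (rule vanishing_ideal)
  have "stanley_reisner_ideal m \<Delta> \<subseteq> (vanishing :: 'k mpoly set)"
    "var_powers_ideal m n \<subseteq> (vanishing :: 'k mpoly set)"
    unfolding stanley_reisner_ideal_def var_powers_ideal_def
    by (intro R.genideal_minimal vanishing_ideal generators_closed)+
  then show "I \<subseteq> (vanishing :: 'k mpoly set)"
    unfolding artinian_ideal_def set_add_def' using N.a_closed by blast
  show "vanishing \<subseteq> (I :: 'k mpoly set)"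
  proof
    fix p :: "'k mpoly" assume p: "p \<in> vanishing"
    have sum: "(\<Sum>u\<in>S. f u) \<in> I" if "finite S" "\<And>u. u \<in> S \<Longrightarrow> f u \<in> I" for S and f :: "(nat \<Rightarrow>\<^sub>0 nat) \<Rightarrow> 'k mpoly"
      using that
    proof (induction S rule: finite_induct)
      case empty
      then show ?case using I.zero_closed by (simp add: R_simps)
    next
      case (insert u S)
      then have "f u \<oplus>\<^bsub>R\<^esub> (\<Sum>u\<in>S. f u) \<in> I" by (intro I.a_closed) auto
      then show ?case using insert by (simp add: R_simps)
    qed
    have "(\<Sum>u\<in>Poly_Mapping.keys p. Poly_Mapping.single u (Poly_Mapping.lookup p u)) \<in> I"
      using p by (intro sum nonstandard_single_in_I finite_keys)
        (auto simp: vanishing_def R_carrier in_keys_iff)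
    then show "p \<in> I" by (simp only: sum_monomials)
  qed
qed

lemma I_iff: "p \<in> I \<longleftrightarrow> p \<in> carrier R \<and> (\<forall>a\<in>E. Poly_Mapping.lookup p a = 0)"
  unfolding I_eq_vanishing by (simp only: vanishing_def mem_Collect_eq)

text \<open>Independent of the chosen representative only for standard exponents \<open>a\<close>.\<close>

definition coset_coeff :: "(nat \<Rightarrow>\<^sub>0 nat) \<Rightarrow> 'k::field mpoly set \<Rightarrow> 'k" where
  "coset_coeff a x = Poly_Mapping.lookup (SOME p. p \<in> x) a"

lemma coset_coeff_eq:
  fixes p :: "'k::field mpoly"
  assumes p: "p \<in> carrier R" and a: "a \<in> E"
  shows "coset_coeff a (I +>\<^bsub>R\<^esub> p) = Poly_Mapping.lookup p a"
proof -
  have "p \<in> I +>\<^bsub>R\<^esub> p" using I.a_rcos_self[OF p] .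
  then have "(SOME q. q \<in> I +>\<^bsub>R\<^esub> p) \<in> I +>\<^bsub>R\<^esub> p" by (rule someI)
  then obtain h where h: "h \<in> I" "(SOME q. q \<in> I +>\<^bsub>R\<^esub> p) = h + p"
    unfolding a_r_coset_def' R_simps by blast
  have "Poly_Mapping.lookup h a = 0" using h(1) a I_iff by blast
  then show ?thesis
    unfolding coset_coeff_def h(2) by (simp add: lookup_add)
qed

section \<open>The quotient algebra and its coordinates\<close>

abbreviation Q :: "('k::field, 'k mpoly set) module" where "Q \<equiv> artinian_SR_algebra m \<Delta> n"

lemma Q_carrier: "x \<in> carrier Q \<longleftrightarrow> (\<exists>p\<in>carrier R. x = I +>\<^bsub>R\<^esub> p)"
  by (auto simp: artinian_SR_algebra_def quotient_algebra_def FactRing_def A_RCOSETS_def')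

lemma coset_in_Q: "p \<in> carrier R \<Longrightarrow> I +>\<^bsub>R\<^esub> p \<in> carrier Q"
  unfolding Q_carrier by blast

lemma Q_add: "p \<in> carrier R \<Longrightarrow> q \<in> carrier R \<Longrightarrow>
    (I +>\<^bsub>R\<^esub> p) \<oplus>\<^bsub>Q\<^esub> (I +>\<^bsub>R\<^esub> q) = I +>\<^bsub>R\<^esub> (p + q)"
  using I.a_rcos_sum[of p q]
  by (simp add: artinian_SR_algebra_def quotient_algebra_def FactRing_def R_simps)

lemma Q_mult: "p \<in> carrier R \<Longrightarrow> q \<in> carrier R \<Longrightarrow>
    (I +>\<^bsub>R\<^esub> p) \<otimes>\<^bsub>Q\<^esub> (I +>\<^bsub>R\<^esub> q) = I +>\<^bsub>R\<^esub> (p * q)"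
  using I.rcoset_mult_add[of p q]
  by (simp add: artinian_SR_algebra_def quotient_algebra_def FactRing_def R_simps)

lemma scalar_in_R: "Poly_Mapping.single 0 c \<in> carrier R"
  by (simp add: R_carrier)

lemma Q_smult: "p \<in> carrier R \<Longrightarrow> c \<odot>\<^bsub>Q\<^esub> (I +>\<^bsub>R\<^esub> p) = I +>\<^bsub>R\<^esub> (Poly_Mapping.single 0 c * p)"
  using I.rcoset_mult_add[of "Poly_Mapping.single 0 c" p] scalar_in_R[of c]
  by (simp add: artinian_SR_algebra_def quotient_algebra_def FactRing_def R_simps)

lemma Q_one: "\<one>\<^bsub>Q\<^esub> = I +>\<^bsub>R\<^esub> 1"
  by (simp add: artinian_SR_algebra_def quotient_algebra_def FactRing_def R_simps)

lemma R_add_closed: "p \<in> carrier R \<Longrightarrow> q \<in> carrier R \<Longrightarrow> p + q \<in> carrier R"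
  using R.a_closed[of p q] by (simp add: R_simps)

lemma R_mult_closed: "p \<in> carrier R \<Longrightarrow> q \<in> carrier R \<Longrightarrow> p * q \<in> carrier R"
  using R.m_closed[of p q] by (simp add: R_simps)

lemma coset_eqI:
  fixes p q :: "'k::field mpoly"
  assumes pq: "p \<in> carrier R" "q \<in> carrier R"
    and eq: "\<And>a. a \<in> E \<Longrightarrow> Poly_Mapping.lookup p a = Poly_Mapping.lookup q a"
  shows "I +>\<^bsub>R\<^esub> p = I +>\<^bsub>R\<^esub> q"
proof -
  have "- q \<in> carrier R" "\<ominus>\<^bsub>R\<^esub> q = - q"
    using pq R.minus_equality[of "- q" q] by (auto simp: R_simps R_carrier)
  then have "p \<ominus>\<^bsub>R\<^esub> q = p + (- q)" "p + (- q) \<in> carrier R"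
    using R_add_closed[of p "- q"] pq by (simp_all add: a_minus_def R_simps)
  moreover have "Poly_Mapping.lookup (p + (- q)) a = 0" if "a \<in> E" for a
    using eq[OF that] by (simp add: lookup_minus)
  ultimately have "p \<ominus>\<^bsub>R\<^esub> q \<in> I" by (simp add: I_iff)
  then show ?thesis
    using R.quotient_eq_iff_same_a_r_cos[OF I.ideal_axioms pq] by blast
qed

lemma monomial_algebra_Q: "monomial_algebra (Q :: ('k::field, 'k mpoly set) module) E coset_coeff"
proof (rule monomial_algebra.intro)
  show "algebra (ring_of_type_algebra :: 'k ring) Q" by (rule algebra_artinian_SR_algebra)
  show "finite E" by (rule finite_E)
  show "0 \<in> E" by (rule zero_in_E)
  show "a \<in> E" if "a + b \<in> E" for a b using that by (rule E_downward)
next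
  fix x y :: "'k mpoly set"
  assume x: "x \<in> carrier Q" and y: "y \<in> carrier Q"
  then obtain p q where pq: "p \<in> carrier R" "q \<in> carrier R" "x = I +>\<^bsub>R\<^esub> p" "y = I +>\<^bsub>R\<^esub> q"
    by (auto simp: Q_carrier)
  show "x = y" if "\<And>a. a \<in> E \<Longrightarrow> coset_coeff a x = coset_coeff a y"
    unfolding pq(3,4) using that pq by (intro coset_eqI) (simp_all add: coset_coeff_eq)
  fix a assume a: "a \<in> E"
  show "coset_coeff a (x \<oplus>\<^bsub>Q\<^esub> y) = coset_coeff a x + coset_coeff a y"
    using pq a by (simp add: Q_add coset_coeff_eq R_add_closed lookup_add)
  show "coset_coeff a (x \<otimes>\<^bsub>Q\<^esub> y) =
      (\<Sum>b\<in>E. \<Sum>c\<in>E. if b + c = a then coset_coeff b x * coset_coeff c y else 0)"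
    using pq a lookup_mult_downward[OF finite_E E_downward a, where p = p and q = q]
    by (simp add: Q_mult coset_coeff_eq R_mult_closed cong: if_cong sum.cong)
next
  fix x :: "'k mpoly set" and a and c :: 'k
  assume x: "x \<in> carrier Q" and a: "a \<in> E"
  then obtain p where p: "p \<in> carrier R" "x = I +>\<^bsub>R\<^esub> p" by (auto simp: Q_carrier)
  have "Poly_Mapping.lookup (Poly_Mapping.single 0 c * p) a = (\<Sum>u\<in>E. \<Sum>v\<in>E.
      if u + v = a then Poly_Mapping.lookup (Poly_Mapping.single 0 c) u * Poly_Mapping.lookup p v else 0)"
    by (rule lookup_mult_downward[OF finite_E _ a]) (rule E_downward)
  also have "\<dots> = (\<Sum>u\<in>E. if u = 0 then (\<Sum>v\<in>E. if v = a then c * Poly_Mapping.lookup p v else 0) else 0)"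
    by (intro sum.cong refl) (auto simp: lookup_single when_def intro!: sum.cong sum.neutral)
  also have "\<dots> = c * Poly_Mapping.lookup p a" using a zero_in_E finite_E by simp
  finally show "coset_coeff a (c \<odot>\<^bsub>Q\<^esub> x) = c * coset_coeff a x"
    using p a by (simp add: Q_smult coset_coeff_eq R_mult_closed scalar_in_R)
next
  fix f :: "(nat \<Rightarrow>\<^sub>0 nat) \<Rightarrow> 'k"
  let ?p = "\<Sum>a\<in>E. Poly_Mapping.single a (f a)"
  have lookup_p: "Poly_Mapping.lookup ?p a = (if a \<in> E then f a else 0)" for a
    using finite_E by (simp add: lookup_sum lookup_single when_def)
  then have "t \<in> E" if "t \<in> Poly_Mapping.keys ?p" for t
    using that by (auto simp: in_keys_iff split: if_splits)
  then have "?p \<in> carrier R" unfolding R_carrier using E_keys by blast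
  then show "\<exists>x\<in>carrier Q. \<forall>a\<in>E. coset_coeff a x = f a"
    using lookup_p by (intro bexI[of _ "I +>\<^bsub>R\<^esub> ?p"]) (auto simp: Q_carrier coset_coeff_eq)
next
  fix a assume "a \<in> E"
  moreover have "1 \<in> carrier (R :: ('k, 'k mpoly) module)" using R.one_closed by (simp add: R_simps)
  ultimately show "coset_coeff a \<one>\<^bsub>Q\<^esub> = (if a = 0 then 1 else (0 :: 'k))"
    by (simp add: Q_one coset_coeff_eq lookup_one when_def)
qed

text \<open>Forms of positive degree have no constant term. Conversely a representative without
  constant term is the sum of its homogeneous parts.\<close>

lemma graded_maximal_ideal_Q:
  "graded_maximal_ideal (Q :: ('k::field, 'k mpoly set) module) (artinian_SR_grading m \<Delta> n) =
     monomial_algebra.maxideal Q coset_coeff"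
proof -
  interpret Q: monomial_algebra "Q :: ('k, 'k mpoly set) module" E coset_coeff
    by (rule monomial_algebra_Q)
  let ?gr = "artinian_SR_grading m \<Delta> n :: nat \<Rightarrow> 'k mpoly set set"
  have gr: "x \<in> carrier Q \<and> coset_coeff 0 x = 0" if x: "x \<in> ?gr d" and d: "d \<ge> 1" for x d
  proof -
    obtain p where p: "p \<in> homogeneous_polys {1..m} d" "x = I +>\<^bsub>R\<^esub> p"
      using x unfolding artinian_SR_grading_def by blast
    then have pR: "p \<in> carrier R" by (simp add: homogeneous_polys_def)
    have "0 \<notin> Poly_Mapping.keys p"
      using p(1) d by (auto simp: homogeneous_polys_def total_degree_def)
    then show ?thesis using p(2) pR zero_in_E by (auto simp: coset_in_Q coset_coeff_eq in_keys_iff)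
  qed
  show ?thesis
  proof (intro Set.set_eqI iffI)
    fix x assume "x \<in> graded_maximal_ideal Q ?gr"
    then obtain f D where D: "x = finsum Q f D" "finite D" "D \<subseteq> {1..}" "\<forall>d\<in>D. f d \<in> ?gr d"
      by (auto simp: graded_maximal_ideal_def family_sum_def)
    have f: "f d \<in> carrier Q" "coset_coeff 0 (f d) = 0" if "d \<in> D" for d
      using gr[of "f d" d] D(3,4) that by auto
    then have "coset_coeff 0 x = 0" using D(1,2) zero_in_E by (simp add: Q.cf_finsum)
    moreover have "x \<in> carrier Q" unfolding D(1) using f by (intro Q.finsum_closed) auto
    ultimately show "x \<in> Q.maxideal" by (simp add: Q.maxideal_def)
  next
    fix x assume x: "x \<in> Q.maxideal"
    then obtain p where p: "p \<in> carrier R" "x = I +>\<^bsub>R\<^esub> p" by (auto simp: Q.maxideal_def Q_carrier)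
    have p0: "0 \<notin> Poly_Mapping.keys p"
      using x p zero_in_E by (simp add: Q.maxideal_def coset_coeff_eq in_keys_iff)
    \<comment> \<open>The finitely many degrees occurring in \<open>p\<close>; zero is not among
      them by \<open>p0\<close>.\<close>
    define D where "D = total_degree ` Poly_Mapping.keys p"
    define q where "q d = (\<Sum>t\<in>{t \<in> Poly_Mapping.keys p. total_degree t = d}.
      Poly_Mapping.single t (Poly_Mapping.lookup p t))" for d
    have lookup_q: "Poly_Mapping.lookup (q d) t = (if total_degree t = d then Poly_Mapping.lookup p t else 0)" for d t
      by (auto simp: q_def lookup_sum lookup_single when_def in_keys_iff)
    have q_hom: "q d \<in> homogeneous_polys {1..m} d" for d
      using p(1) by (auto simp: homogeneous_polys_def R_carrier in_keys_iff lookup_q split: if_splits)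
    then have qR: "q d \<in> carrier R" for d by (simp add: homogeneous_polys_def)
    have xfin: "x = finsum Q (\<lambda>d. I +>\<^bsub>R\<^esub> q d) D"
    proof (rule Q.cf_eqI)
      fix b assume b: "b \<in> E"
      have "coset_coeff b (finsum Q (\<lambda>d. I +>\<^bsub>R\<^esub> q d) D) = (\<Sum>d\<in>D. coset_coeff b (I +>\<^bsub>R\<^esub> q d))"
        using b qR by (intro Q.cf_finsum) (auto simp: D_def coset_in_Q)
      also have "\<dots> = (\<Sum>d\<in>D. if total_degree b = d then Poly_Mapping.lookup p b else 0)"
        using b qR by (intro sum.cong refl) (simp add: coset_coeff_eq lookup_q)
      also have "\<dots> = Poly_Mapping.lookup p b" by (auto simp: D_def in_keys_iff)
      finally show "coset_coeff b x = coset_coeff b (finsum Q (\<lambda>d. I +>\<^bsub>R\<^esub> q d) D)"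
        using p b by (simp add: coset_coeff_eq)
    next
      show "finsum Q (\<lambda>d. I +>\<^bsub>R\<^esub> q d) D \<in> carrier Q"
        using qR by (intro Q.finsum_closed) (auto simp: coset_in_Q)
    qed (use p in \<open>auto simp: coset_in_Q\<close>)
    have "D \<subseteq> {1..}"
    proof -
      have "1 \<le> total_degree t" if "t \<in> Poly_Mapping.keys p" for t
      proof -
        have "t \<noteq> 0" using that p0 by auto
        then obtain i where i: "i \<in> Poly_Mapping.keys t" by (metis all_not_in_conv keys_eq_empty)
        then have "Poly_Mapping.lookup t i \<le> total_degree t"
          unfolding total_degree_def by (intro member_le_sum) auto
        then show ?thesis using i by (simp add: in_keys_iff)
      qed
      then show ?thesis by (auto simp: D_def)
    qed
    moreover have "\<forall>d\<in>D. I +>\<^bsub>R\<^esub> q d \<in> ?gr d" using q_hom by (auto simp: artinian_SR_grading_def)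
    ultimately show "x \<in> graded_maximal_ideal Q ?gr"
      unfolding graded_maximal_ideal_def family_sum_def
      using xfin by (intro CollectI exI[of _ "\<lambda>d. I +>\<^bsub>R\<^esub> q d"] exI[of _ D]) (auto simp: D_def)
  qed
qed

end

declare One_nat_def [simp]

theorem theoremC:
  fixes K :: "'k::field ring"
    and m :: nat
    and \<Delta> :: "nat set set"
    and n :: "nat \<Rightarrow> nat"
    and A :: "('k, 'k mpoly set) module"
    and gr :: "nat \<Rightarrow> 'k mpoly set set"
  assumes "K = ring_of_type_algebra"
    and "simplicial_complex {1..m} \<Delta>"
    and "\<forall>i\<in>{1..m}. \<not> ghost_vertex \<Delta> i"
    and "\<forall>i\<in>{1..m}. n i \<ge> 2"
    and "A = artinian_SR_algebra m \<Delta> n"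
    and "gr = artinian_SR_grading m \<Delta> n"
    and "\<not> gorenstein K A gr"
    and "nearly_gorenstein K A gr"
  shows "teter_number K A = Max ({1} \<union> {card C | C. C \<in> simplex_components {1..m} \<Delta>})
    \<and> (teter_type K A gr \<longleftrightarrow> (\<forall>C\<in>simplex_components {1..m} \<Delta>. is_singleton C))"
proof -
  have n_pos: "n i > 0" if "i \<in> {1..m}" for i
    using assms(4) that by (metis less_le_trans zero_less_numeral)
  interpret P: SR_presentation m \<Delta> n
    using assms(2) n_pos by unfold_locales
  interpret monomial_algebra A "standard_exponents \<Delta> n" P.coset_coeff
    unfolding assms(5) by (rule P.monomial_algebra_Q)
  have gr: "graded_maximal_ideal A gr = maxideal"
    unfolding assms(5,6) by (rule P.graded_maximal_ideal_Q)
  interpret nearly_gorenstein_SR A "{1..m}" \<Delta> n P.coset_coeff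
  proof
    \<comment> \<open>A nonzero constant term would make the algebra Gorenstein.\<close>
    show "P.coset_coeff 0 (\<phi> l) = 0" if "\<phi> \<in> H" "l \<in> carrier W" for \<phi> l
      using gorenstein_if_hom_hits_unit[OF gr that] assms(1,7) by blast
    show "maxideal \<subseteq> canonical_trace ring_of_type_algebra A"
      using assms(1,8) by (simp add: nearly_gorenstein_def gr)
  qed (use assms(2-4) in auto)
  show ?thesis
    using teter_number_eq max_size_eq_1_iff assms(1,7)
    unfolding max_size_def[symmetric] teter_type_def by auto
qed

end
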